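(* Let $k$ be a finite field of characteristic $p$, let $G$ be a profinite group and let $U$ be an indecomposable finitely generated profinite $k[[G]]$-module. Then $U$ has local endomorphism ring; that is, $\mathrm{End}_{k[[G]]}(U)$ is a local ring.
   Context: $k[[G]]=\varprojlim_{N} k[G/N]$ ($N$ over open normal subgroups of $G$) is the completed group algebra. A profinite $k[[G]]$-module is a profinite abelian group with a continuous $k[[G]]$-action (left modules). $\mathrm{End}_{k[[G]]}(U)$ is the ring of continuous $k[[G]]$-module endomorphisms of $U$. Indecomposable means non-zero and not a direct sum of two non-zero profinite submodules. A (not necessarily commutative) ring is local if its non-units form an ideal (equivalently, are closed under addition, with $1\ne0$). *)

theory Defs
  imports "HOL-Analysis.Analysis" "HOL-Algebra.Algebra"
begin

section \<open>Profinite groups\<close>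

definition totally_disconnected_space :: "'a topology \<Rightarrow> bool" where
  "totally_disconnected_space S \<longleftrightarrow> (\<forall>C. connectedin S C \<longrightarrow> (\<exists>a. C \<subseteq> {a}))"

locale topological_group = group G for G (structure) +
  fixes T :: "'a topology"
  assumes topspace_eq: "topspace T = carrier G"
    and continuous_mult: "continuous_map (prod_topology T T) T (\<lambda>(x, y). x \<otimes> y)"
    and continuous_inv: "continuous_map T T (\<lambda>x. inv x)"

locale profinite_group = topological_group +
  assumes compact: "compact_space T"
    and Hausdorff: "Hausdorff_space T"
    and totally_disconnected: "totally_disconnected_space T"

definition open_normal_subgroups :: "('g, 'a) monoid_scheme \<Rightarrow> 'g topology \<Rightarrow> 'g set set" where
  "open_normal_subgroups G T = {N. N \<lhd> G \<and> openin T N}"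


section \<open>The completed group algebra\<close>

definition ring_characteristic :: "('k, 'a) ring_scheme \<Rightarrow> nat" where
  "ring_characteristic R = group.ord (add_monoid R) \<one>\<^bsub>R\<^esub>"

definition support :: "('k, 'a) ring_scheme \<Rightarrow> ('h, 'b) monoid_scheme \<Rightarrow> ('h \<Rightarrow> 'k) \<Rightarrow> 'h set" where
  "support k H a = {h \<in> carrier H. a h \<noteq> \<zero>\<^bsub>k\<^esub>}"

text \<open>The element \<open>\<Sum>\<^sub>h a\<^sub>h h\<close> of the group algebra \<open>k[H]\<close> is represented by its finitely supported
  coefficient function; multiplication is convolution.\<close>

definition group_algebra :: "('k, 'a) ring_scheme \<Rightarrow> ('h, 'b) monoid_scheme \<Rightarrow> ('h \<Rightarrow> 'k) ring" where
  "group_algebra k H =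
    \<lparr>carrier = {a \<in> carrier H \<rightarrow>\<^sub>E carrier k. finite (support k H a)},
     mult = (\<lambda>a b. \<lambda>h\<in>carrier H.
       \<Oplus>\<^bsub>k\<^esub>x\<in>support k H a. a x \<otimes>\<^bsub>k\<^esub> b (inv\<^bsub>H\<^esub> x \<otimes>\<^bsub>H\<^esub> h)),
     one = (\<lambda>h\<in>carrier H. if h = \<one>\<^bsub>H\<^esub> then \<one>\<^bsub>k\<^esub> else \<zero>\<^bsub>k\<^esub>),
     ring.zero = (\<lambda>h\<in>carrier H. \<zero>\<^bsub>k\<^esub>),
     add = (\<lambda>a b. \<lambda>h\<in>carrier H. a h \<oplus>\<^bsub>k\<^esub> b h)\<rparr>"

text \<open>The \<open>k\<close>-linear map \<open>k[H] \<rightarrow> k[H']\<close> extending \<open>f : H \<rightarrow> H'\<close>.\<close>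

definition group_algebra_map ::
    "('k, 'a) ring_scheme \<Rightarrow> ('h, 'b) monoid_scheme \<Rightarrow> ('i, 'c) monoid_scheme
      \<Rightarrow> ('h \<Rightarrow> 'i) \<Rightarrow> ('h \<Rightarrow> 'k) \<Rightarrow> ('i \<Rightarrow> 'k)" where
  "group_algebra_map k H H' f a =
    (\<lambda>h'\<in>carrier H'. \<Oplus>\<^bsub>k\<^esub>h\<in>{h \<in> support k H a. f h = h'}. a h)"

text \<open>The inverse limit of the algebras \<open>k[G/N]\<close>, as the ring of compatible families. For
  \<open>N \<subseteq> M\<close> the projection \<open>G/N \<rightarrow> G/M\<close> is \<open>C \<mapsto> MC\<close>.\<close>

definition completed_group_algebra ::
    "('k, 'a) ring_scheme \<Rightarrow> ('g, 'b) monoid_scheme \<Rightarrow> 'g topology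
      \<Rightarrow> ('g set \<Rightarrow> 'g set \<Rightarrow> 'k) ring" where
  "completed_group_algebra k G T =
    \<lparr>carrier = {x \<in> (\<Pi>\<^sub>E N\<in>open_normal_subgroups G T. carrier (group_algebra k (G Mod N))).
       \<forall>N\<in>open_normal_subgroups G T. \<forall>M\<in>open_normal_subgroups G T. N \<subseteq> M \<longrightarrow>
         group_algebra_map k (G Mod N) (G Mod M) (\<lambda>C. M <#>\<^bsub>G\<^esub> C) (x N) = x M},
     mult = (\<lambda>x y. \<lambda>N\<in>open_normal_subgroups G T. x N \<otimes>\<^bsub>group_algebra k (G Mod N)\<^esub> y N),
     one = (\<lambda>N\<in>open_normal_subgroups G T. \<one>\<^bsub>group_algebra k (G Mod N)\<^esub>),
     ring.zero = (\<lambda>N\<in>open_normal_subgroups G T. \<zero>\<^bsub>group_algebra k (G Mod N)\<^esub>),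
     add = (\<lambda>x y. \<lambda>N\<in>open_normal_subgroups G T. x N \<oplus>\<^bsub>group_algebra k (G Mod N)\<^esub> y N)\<rparr>"

text \<open>The inverse limit topology for finite \<open>k\<close>, in which case every \<open>k[G/N]\<close> is finite and
  hence discrete.\<close>

definition completed_group_algebra_topology ::
    "('k, 'a) ring_scheme \<Rightarrow> ('g, 'b) monoid_scheme \<Rightarrow> 'g topology
      \<Rightarrow> ('g set \<Rightarrow> 'g set \<Rightarrow> 'k) topology" where
  "completed_group_algebra_topology k G T =
    subtopology
      (product_topology (\<lambda>N. discrete_topology (carrier (group_algebra k (G Mod N))))
        (open_normal_subgroups G T))
      (carrier (completed_group_algebra k G T))"


section \<open>Profinite modules\<close>

text \<open>The library's locale of modules is restricted to commutative rings.\<close>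

locale left_module = R?: ring R + M?: abelian_group M
  for R :: "('r, 'a) ring_scheme" (structure) and M :: "('r, 'm, 'b) module_scheme" (structure) +
  assumes smult_closed [simp, intro]:
      "\<lbrakk>a \<in> carrier R; x \<in> carrier M\<rbrakk> \<Longrightarrow> a \<odot>\<^bsub>M\<^esub> x \<in> carrier M"
    and smult_l_distr:
      "\<lbrakk>a \<in> carrier R; b \<in> carrier R; x \<in> carrier M\<rbrakk> \<Longrightarrow>
        (a \<oplus> b) \<odot>\<^bsub>M\<^esub> x = a \<odot>\<^bsub>M\<^esub> x \<oplus>\<^bsub>M\<^esub> b \<odot>\<^bsub>M\<^esub> x"
    and smult_r_distr:
      "\<lbrakk>a \<in> carrier R; x \<in> carrier M; y \<in> carrier M\<rbrakk> \<Longrightarrow>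
        a \<odot>\<^bsub>M\<^esub> (x \<oplus>\<^bsub>M\<^esub> y) = a \<odot>\<^bsub>M\<^esub> x \<oplus>\<^bsub>M\<^esub> a \<odot>\<^bsub>M\<^esub> y"
    and smult_assoc:
      "\<lbrakk>a \<in> carrier R; b \<in> carrier R; x \<in> carrier M\<rbrakk> \<Longrightarrow>
        (a \<otimes> b) \<odot>\<^bsub>M\<^esub> x = a \<odot>\<^bsub>M\<^esub> (b \<odot>\<^bsub>M\<^esub> x)"
    and smult_one [simp]:
      "x \<in> carrier M \<Longrightarrow> \<one> \<odot>\<^bsub>M\<^esub> x = x"

locale profinite_module = left_module R M + additive: profinite_group "add_monoid M" TM
  for R :: "('r, 'a) ring_scheme" (structure) and TR :: "'r topology"
    and M :: "('r, 'm, 'b) module_scheme" (structure) and TM :: "'m topology" +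
  assumes continuous_smult:
    "continuous_map (prod_topology TR TM) TM (\<lambda>(a, x). a \<odot>\<^bsub>M\<^esub> x)"

definition profinite_submodule ::
    "('r, 'a) ring_scheme \<Rightarrow> ('r, 'm, 'b) module_scheme \<Rightarrow> 'm topology \<Rightarrow> 'm set \<Rightarrow> bool" where
  "profinite_submodule R M TM V \<longleftrightarrow> submodule V R M \<and> closedin TM V"

text \<open>Generation is meant topologically, as usual for profinite modules.\<close>

definition finitely_generated ::
    "('r, 'a) ring_scheme \<Rightarrow> ('r, 'm, 'b) module_scheme \<Rightarrow> 'm topology \<Rightarrow> bool" where
  "finitely_generated R M TM \<longleftrightarrow>
    (\<exists>S. finite S \<and> S \<subseteq> carrier M \<and>
      (\<forall>V. profinite_submodule R M TM V \<and> S \<subseteq> V \<longrightarrow> V = carrier M))"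

definition indecomposable ::
    "('r, 'a) ring_scheme \<Rightarrow> ('r, 'm, 'b) module_scheme \<Rightarrow> 'm topology \<Rightarrow> bool" where
  "indecomposable R M TM \<longleftrightarrow>
    carrier M \<noteq> {\<zero>\<^bsub>M\<^esub>} \<and>
    \<not> (\<exists>V W. profinite_submodule R M TM V \<and> profinite_submodule R M TM W \<and>
        V \<noteq> {\<zero>\<^bsub>M\<^esub>} \<and> W \<noteq> {\<zero>\<^bsub>M\<^esub>} \<and>
        V <+>\<^bsub>M\<^esub> W = carrier M \<and> V \<inter> W = {\<zero>\<^bsub>M\<^esub>})"

definition endomorphism_ring ::
    "('r, 'a) ring_scheme \<Rightarrow> ('r, 'm, 'b) module_scheme \<Rightarrow> 'm topology \<Rightarrow> ('m \<Rightarrow> 'm) ring" where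
  "endomorphism_ring R M TM =
    \<lparr>carrier = {f \<in> carrier M \<rightarrow>\<^sub>E carrier M.
       (\<forall>x\<in>carrier M. \<forall>y\<in>carrier M. f (x \<oplus>\<^bsub>M\<^esub> y) = f x \<oplus>\<^bsub>M\<^esub> f y) \<and>
       (\<forall>a\<in>carrier R. \<forall>x\<in>carrier M. f (a \<odot>\<^bsub>M\<^esub> x) = a \<odot>\<^bsub>M\<^esub> f x) \<and>
       continuous_map TM TM f},
     mult = (\<lambda>f g. \<lambda>x\<in>carrier M. f (g x)),
     one = (\<lambda>x\<in>carrier M. x),
     ring.zero = (\<lambda>x\<in>carrier M. \<zero>\<^bsub>M\<^esub>),
     add = (\<lambda>f g. \<lambda>x\<in>carrier M. f x \<oplus>\<^bsub>M\<^esub> g x)\<rparr>"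


section \<open>Local rings\<close>

text \<open>The zero ring is excluded: there \<open>0\<close> is a unit, so the set of non-units is empty and
  not an ideal.\<close>

definition local_ring :: "('r, 'a) ring_scheme \<Rightarrow> bool" where
  "local_ring R \<longleftrightarrow> ring R \<and> ideal (carrier R - Units R) R"

end

theory Submission
  imports Defs
begin

text \<open>
  Since the scalar ring is compact, the open submodules of \<open>U\<close> form a neighbourhood basis of \<open>0\<close>.
  Modulo an open submodule \<open>V\<close> an endomorphism is determined by the cosets of the images of the
  finitely many generators, so the sets \<open>f\<^sup>-\<^sup>1(V)\<close> are finite in number and their intersection is an
  open fully invariant submodule \<open>W \<subseteq> V\<close>; moreover, some power \<open>f\<^sup>e\<close> with \<open>e > 0\<close> is idempotent
  modulo \<open>W\<close>. By compactness these idempotents assemble to a Fitting decomposition of \<open>U\<close> into two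
  closed submodules, on one of which \<open>f\<close> is bijective and on the other topologically nilpotent.
  As \<open>U\<close> is indecomposable, \<open>f\<close> is a unit or topologically nilpotent, and \<open>f\<close> and \<open>1 - f\<close> cannot both
  be topologically nilpotent. A nonzero ring in which \<open>f\<close> or \<open>1 - f\<close> is always a unit is local.
\<close>

section \<open>A criterion for local rings\<close>

text \<open>The dichotomy leaves only trivial idempotents, so one-sided inverses are two-sided and
  both factors of a unit are units. If \<open>a \<oplus> b\<close> is a unit with inverse v, then va
  + vb = 1 makes va or vb a unit, hence a or b.\<close>

lemma (in ring) unit_or_one_minus_unit_imp_local_ring:
  assumes nontrivial: "\<one> \<noteq> \<zero>"
    and dichotomy: "\<And>a. a \<in> carrier R \<Longrightarrow> a \<in> Units R \<or> \<one> \<ominus> a \<in> Units R"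
  shows "local_ring R"
proof -
  have one_sided: "y \<otimes> x = \<one>"
    if x: "x \<in> carrier R" and y: "y \<in> carrier R" and xy: "x \<otimes> y = \<one>" for x y
  proof -
    \<comment> \<open>\<open>y x\<close> is idempotent, hence \<open>0\<close> or \<open>1\<close>.\<close>
    define e where "e = y \<otimes> x"
    have e: "e \<in> carrier R" using x y by (simp add: e_def)
    have "e \<otimes> e = y \<otimes> (x \<otimes> y) \<otimes> x" using x y by (simp add: e_def m_assoc)
    then have ee: "e \<otimes> e = e" using x y xy by (simp add: e_def)
    from dichotomy[OF e] show ?thesis
    proof
      assume u: "e \<in> Units R"
      have "e = inv e \<otimes> (e \<otimes> e)" using u e by (simp add: m_assoc[symmetric])
      then have "e = \<one>" using u ee by simp
      then show ?thesis by (simp add: e_def)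
    next
      assume u: "\<one> \<ominus> e \<in> Units R"
      have "(\<one> \<ominus> e) \<otimes> e = \<zero>" using e ee by (simp add: minus_eq l_distr l_minus r_neg)
      then have "inv (\<one> \<ominus> e) \<otimes> ((\<one> \<ominus> e) \<otimes> e) = \<zero>" using u by simp
      then have "e = \<zero>" using u e by (simp add: m_assoc[symmetric])
      \<comment> \<open>The right side is 1 because xy = 1, while \<open>e = \<zero>\<close> makes
        the left side 0.\<close>
      moreover have "x \<otimes> e \<otimes> y = (x \<otimes> y) \<otimes> (x \<otimes> y)" using x y by (simp add: e_def m_assoc)
      ultimately have False using x y xy nontrivial by simp
      then show ?thesis ..
    qed
  qed
  have left_factor: "a \<in> Units R"
    if a: "a \<in> carrier R" and b: "b \<in> carrier R" and u: "a \<otimes> b \<in> Units R" for a b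
  proof -
    have "a \<otimes> (b \<otimes> inv (a \<otimes> b)) = \<one>" using a b u by (simp add: m_assoc[symmetric])
    moreover have "b \<otimes> inv (a \<otimes> b) \<in> carrier R" using b u by simp
    moreover have "b \<otimes> inv (a \<otimes> b) \<otimes> a = \<one>"
      by (rule one_sided[OF a calculation(2,1)])
    ultimately show ?thesis using a unfolding Units_def by blast
  qed
  have right_factor: "b \<in> Units R"
    if a: "a \<in> carrier R" and b: "b \<in> carrier R" and u: "a \<otimes> b \<in> Units R" for a b
  proof -
    have "inv (a \<otimes> b) \<otimes> a \<otimes> b = \<one>" using a b u by (simp add: m_assoc)
    moreover have "inv (a \<otimes> b) \<otimes> a \<in> carrier R" using a u by simp
    moreover have "b \<otimes> (inv (a \<otimes> b) \<otimes> a) = \<one>"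
      by (rule one_sided[OF calculation(2) b calculation(1)])
    ultimately show ?thesis using b unfolding Units_def by blast
  qed
  have add_closed: "a \<in> Units R \<or> b \<in> Units R"
    if a: "a \<in> carrier R" and b: "b \<in> carrier R" and u: "a \<oplus> b \<in> Units R" for a b
  proof -
    let ?v = "inv (a \<oplus> b)"
    have v: "?v \<in> carrier R" using u by simp
    have "?v \<otimes> a \<oplus> ?v \<otimes> b = \<one>" using a b u v by (simp add: r_distr[symmetric])
    then have "\<one> \<ominus> ?v \<otimes> a = ?v \<otimes> a \<oplus> ?v \<otimes> b \<ominus> ?v \<otimes> a" by simp
    also have "\<dots> = ?v \<otimes> b"
      using a b v by (simp add: minus_eq a_assoc a_comm[of "?v \<otimes> b"] r_neg2)

    finally show ?thesis
      using dichotomy[of "?v \<otimes> a"] right_factor[OF v a] right_factor[OF v b] a v by auto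
  qed
  have zero: "\<zero> \<notin> Units R"
    using nontrivial unfolding Units_def by auto
  have "ideal (carrier R - Units R) R"
  proof (rule idealI)
    show "ring R" by (rule ring_axioms)
    show "subgroup (carrier R - Units R) (add_monoid R)"
    proof (rule add.subgroupI)
      show "carrier R - Units R \<noteq> {}" using zero by auto
      show "\<ominus> a \<in> carrier R - Units R" if "a \<in> carrier R - Units R" for a
      proof -
        \<comment> \<open>Writing the negative as a product lets \<open>left_factor\<close> show
          that a is a unit if its negative is one.\<close>
        have "a \<otimes> \<ominus> \<one> = \<ominus> a" using that by (simp add: r_minus)
        then show ?thesis using that left_factor[of a "\<ominus> \<one>"] by auto
      qed
      show "a \<oplus> b \<in> carrier R - Units R"
        if "a \<in> carrier R - Units R" "b \<in> carrier R - Units R" for a b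
        using that add_closed by blast
    qed simp
    show "x \<otimes> a \<in> carrier R - Units R" "a \<otimes> x \<in> carrier R - Units R"
      if "a \<in> carrier R - Units R" "x \<in> carrier R" for a x
      using that left_factor right_factor by blast+
  qed
  then show ?thesis
    by (simp add: local_ring_def ring_axioms)
qed

section \<open>Compact topological groups\<close>

text \<open>In a compact Hausdorff space quasi-components coincide with components, which here are
  points. So clopen sets separate x from the compact complement of B.\<close>

lemma compact_totally_disconnected_clopen_nbhd:
  assumes "compact_space S" and "Hausdorff_space S" and "totally_disconnected_space S"
    and "openin S B" and "x \<in> B"
  obtains C where "openin S C" and "closedin S C" and "x \<in> C" and "C \<subseteq> B"
proof -
  have x: "x \<in> topspace S" using assms(4,5) openin_subset by blast
  obtain a where "connected_component_of_set S x \<subseteq> {a}"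
    using assms(3) connectedin_connected_component_of[of S x]
    unfolding totally_disconnected_space_def by blast
  moreover have "x \<in> connected_component_of_set S x"
    using x by (simp add: connected_component_of_refl)
  ultimately have "connected_component_of_set S x = {x}" by auto
  then have "quasi_component_of_set S x = {x}"
    using quasi_eq_connected_component_of[of S x] assms(1,2) by simp
  then have q: "{x} \<in> quasi_components_of S"
    using x unfolding quasi_components_of_def by force
  have "compactin S (topspace S - B)"
    using assms(1,4) by (intro closedin_compact_space) auto
  then have "separated_between S {x} (topspace S - B)"
    using separated_between_quasi_component_compact[OF q] assms(5) by simp
  then obtain C where "closedin S C" "openin S C" "x \<in> C" "topspace S - B \<subseteq> topspace S - C"
    unfolding separated_between by auto
  moreover from this have "C \<subseteq> B" using openin_subset by blast
  ultimately show thesis using that by blast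
qed

text \<open>A form of the tube lemma: the complement is the projection of a closed set along the
  compact factor S, and such a projection is a closed map.\<close>

lemma openin_forall_compact:
  assumes "compact_space S" and "continuous_map (prod_topology S Y) Z h" and "openin Z A"
  shows "openin Y {y \<in> topspace Y. \<forall>x\<in>topspace S. h (x, y) \<in> A}"
proof -
  let ?P = "{z \<in> topspace (prod_topology S Y). h z \<in> topspace Z - A}"
  have "closedin (prod_topology S Y) ?P"
    using assms(2,3) by (intro closedin_continuous_map_preimage) auto
  then have "closedin Y (snd ` ?P)"
    using closed_map_snd[OF assms(1)] unfolding closed_map_def by blast
  moreover have "h (x, y) \<in> topspace Z" if "x \<in> topspace S" "y \<in> topspace Y" for x y
    using that continuous_map_image_subset_topspace[OF assms(2)] by (auto simp: image_subset_iff)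
  then have "y \<in> snd ` ?P \<longleftrightarrow> (\<exists>x\<in>topspace S. h (x, y) \<notin> A)" if "y \<in> topspace Y" for y
    using that by (auto simp: image_iff)
  then have "topspace Y - snd ` ?P = {y \<in> topspace Y. \<forall>x\<in>topspace S. h (x, y) \<in> A}"
    by blast
  ultimately show ?thesis
    using openin_diff[OF openin_topspace, of Y "snd ` ?P"] by simp
qed

section \<open>Open subgroups and their cosets\<close>

context topological_group
begin

lemma continuous_map_mult:
  assumes "continuous_map S T f" and "continuous_map S T g"
  shows "continuous_map S T (\<lambda>x. f x \<otimes> g x)"
  using continuous_map_compose[OF continuous_map_pairedI[OF assms] continuous_mult]
  by (simp add: o_def)

lemma openin_rcoset:
  assumes "subgroup H G" and "openin T H" and a: "a \<in> carrier G"
  shows "openin T (H #> a)"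
proof -
  interpret H: subgroup H G by fact
  have "continuous_map T T (\<lambda>x. x \<otimes> inv a)"
    using a by (intro continuous_map_mult) (auto simp: topspace_eq)
  then have "openin T {x \<in> topspace T. x \<otimes> inv a \<in> H}"
    using assms(2) by (rule openin_continuous_map_preimage)
  moreover have "x \<in> {x \<in> topspace T. x \<otimes> inv a \<in> H} \<longleftrightarrow> x \<in> H #> a" for x
    using H.rcos_module[OF group_axioms a, of x] H.elemrcos_carrier[OF group_axioms a, of x]
    by (auto simp: topspace_eq)
  then have "{x \<in> topspace T. x \<otimes> inv a \<in> H} = H #> a" by blast
  ultimately show ?thesis by simp
qed

text \<open>The complement is the union of the other cosets, all of which are open.\<close>

lemma closedin_open_subgroup:
  assumes "subgroup H G" and "openin T H"
  shows "closedin T H"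
proof -
  have H: "H \<in> rcosets H" using subgroup.subgroup_in_rcosets[OF assms(1) group_axioms] .
  have "C \<inter> H = {}" if "C \<in> rcosets H" "C \<noteq> H" for C
    using pairwiseD[OF rcos_disjoint[OF assms(1)] that(1) H that(2)] by (simp add: disjnt_def)
  then have "topspace T - H = \<Union>(rcosets H - {H})"
    unfolding topspace_eq rcosets_part_G[OF assms(1), symmetric] by blast
  moreover have "openin T C" if C: "C \<in> rcosets H" for C
  proof -
    obtain a where a: "a \<in> carrier G" and "C = H #> a" using C unfolding RCOSETS_def by blast
    then show ?thesis using openin_rcoset[OF assms a] by simp
  qed
  ultimately have "openin T (topspace T - H)" by auto
  then show ?thesis using assms(2) openin_subset by (simp add: closedin_def)
qed

text \<open>The cosets are a cover by disjoint nonempty open sets, so a finite subcover has to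
  contain every one of them.\<close>

lemma finite_rcosets_open_subgroup:
  assumes "compact_space T" and "subgroup H G" and "openin T H"
  shows "finite (rcosets H)"
proof -
  have "openin T C" if C: "C \<in> rcosets H" for C
  proof -
    obtain a where a: "a \<in> carrier G" and "C = H #> a" using C unfolding RCOSETS_def by blast
    then show ?thesis using openin_rcoset[OF assms(2,3) a] by simp
  qed
  moreover have "\<Union>(rcosets H) = topspace T"
    using rcosets_part_G[OF assms(2)] by (simp add: topspace_eq)
  ultimately have "\<exists>F. finite F \<and> F \<subseteq> rcosets H \<and> \<Union>F = topspace T"
    using assms(1)[unfolded compact_space, rule_format, of "rcosets H"] by simp
  then obtain F where F: "finite F" "F \<subseteq> rcosets H" "\<Union>F = carrier G"
    unfolding topspace_eq by (elim exE conjE)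
  have "C \<in> F" if C: "C \<in> rcosets H" for C
  proof -
    obtain x where x: "x \<in> C" using subgroup.rcosets_non_empty[OF assms(2) C] by blast
    then have "x \<in> \<Union>F" using F rcosets_part_G[OF assms(2)] C by blast
    then obtain D where "D \<in> F" "x \<in> D" by blast
    moreover have "C = D"
    proof (rule ccontr)
      assume "C \<noteq> D"
      moreover have "D \<in> rcosets H" using F(2) \<open>D \<in> F\<close> by blast
      ultimately have "disjnt C D"
        using pairwiseD[OF rcos_disjoint[OF assms(2)] C] by blast
      then show False using x \<open>x \<in> D\<close> by (simp add: disjnt_iff)
    qed
    ultimately show ?thesis by simp
  qed
  then show ?thesis by (intro finite_subset[OF _ F(1)] subsetI)
qed

end

text \<open>Van Dantzig's theorem in the compact case: a clopen neighbourhood C of the identity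
  inside B has an open stabiliser under right translation, and this stabiliser lies in C.\<close>

lemma (in profinite_group) open_subgroup_nbhd:
  assumes "openin T B" and "\<one> \<in> B"
  obtains H where "subgroup H G" and "openin T H" and "H \<subseteq> B"
proof -
  obtain C where C: "openin T C" "closedin T C" "\<one> \<in> C" "C \<subseteq> B"
    using compact_totally_disconnected_clopen_nbhd[OF compact Hausdorff totally_disconnected assms] .
  have CG: "C \<subseteq> carrier G" using openin_subset[OF C(1)] by (simp add: topspace_eq)
  let ?TC = "subtopology T C"
  have K: "compact_space ?TC"
    using C(2) compact closedin_compact_space compact_space_subtopology by blast
  have top: "topspace ?TC = C" using CG by (auto simp: topspace_eq)
  \<comment> \<open>The elements whose right translation stabilises \<open>C\<close> form a subgroup inside \<open>C \<ni> 1\<close>.\<close>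
  define A where "A = {y \<in> carrier G. \<forall>c\<in>C. c \<otimes> y \<in> C}"
  define H where "H = {y \<in> carrier G. y \<in> A \<and> inv y \<in> A}"
  have "continuous_map (prod_topology ?TC T) T (\<lambda>z. fst z \<otimes> snd z)"
    by (intro continuous_map_mult continuous_map_snd continuous_map_into_fulltopology[OF continuous_map_fst])
  \<comment> \<open>The clopen set C is both the compact factor and the open target here.\<close>
  from openin_forall_compact[OF K this C(1)] have A: "openin T A"
    unfolding A_def top topspace_eq by simp
  have "openin T (A \<inter> {y \<in> topspace T. inv y \<in> A})"
    by (intro openin_Int A openin_continuous_map_preimage[OF continuous_inv A])
  moreover have "A \<inter> {y \<in> topspace T. inv y \<in> A} = H"
    unfolding H_def topspace_eq by (auto simp: A_def)
  ultimately have "openin T H" by simp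
  moreover have A_mult: "a \<otimes> b \<in> A" if "a \<in> A" "b \<in> A" for a b
    using that CG by (simp add: A_def m_assoc[symmetric] subset_iff)
  have "subgroup H G"
  proof (rule subgroupI)
    have "\<one> \<in> H" using CG by (auto simp: H_def A_def)
    then show "H \<noteq> {}" by blast
    show "a \<otimes> b \<in> H" if "a \<in> H" "b \<in> H" for a b
      using that by (simp add: H_def inv_mult_group A_mult)
  qed (simp_all add: H_def subset_iff)
  moreover have "y \<in> C" if "y \<in> H" for y
  proof -
    have "\<one> \<otimes> y \<in> C" using that C(3) unfolding H_def A_def by blast
    then show ?thesis using that by (simp add: H_def)
  qed
  then have "H \<subseteq> B" using C(4) by blast
  ultimately show thesis using that by blast
qed

text \<open>Each N has finite index, so each k[G/N] is a finite discrete space. The inverse limit is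
  closed in their product, which is compact by Tychonoff.\<close>

lemma compact_space_completed_group_algebra:
  assumes "profinite_group G T" and "finite (carrier k)"
  shows "compact_space (completed_group_algebra_topology k G T)"
    and "topspace (completed_group_algebra_topology k G T) = carrier (completed_group_algebra k G T)"
proof -
  interpret profinite_group G T by fact
  define I where "I = open_normal_subgroups G T"
  define A where "A N = carrier (group_algebra k (G Mod N))" for N
  define P where "P = product_topology (\<lambda>N. discrete_topology (A N)) I"
  define \<phi> where "\<phi> N M = group_algebra_map k (G Mod N) (G Mod M) (\<lambda>C. M <#>\<^bsub>G\<^esub> C)" for N M
  have finA: "finite (A N)" if "N \<in> I" for N
  proof -
    have N: "subgroup N G" "openin T N"
      using that by (auto simp: I_def open_normal_subgroups_def normal_imp_subgroup)
    have "finite (carrier (G Mod N))"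
      using finite_rcosets_open_subgroup[OF compact N] by (simp add: FactGroup_def)
    then have "finite (carrier (G Mod N) \<rightarrow>\<^sub>E carrier k)"
      using assms(2) by (intro finite_PiE) auto
    then show ?thesis by (simp add: A_def group_algebra_def)
  qed
  have topP: "topspace P = (\<Pi>\<^sub>E N\<in>I. A N)" by (simp add: P_def)
  have "compact_space P"
    using finA by (simp add: P_def compact_space_product_topology compact_space_discrete_topology)
  define L where "L = carrier (completed_group_algebra k G T)"
  \<comment> \<open>Inserting \<open>topspace P\<close> keeps the intersection inside the product
    and makes the family nonempty without exhibiting an open normal subgroup.\<close>
  have L: "L = \<Inter>(insert (topspace P) {{x \<in> topspace P. \<phi> N M (x N) = x M} | N M. N \<in> I \<and> M \<in> I \<and> N \<subseteq> M})"
    unfolding L_def topP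
    by (auto simp: completed_group_algebra_def I_def A_def \<phi>_def)
  have proj: "continuous_map P (discrete_topology (A N)) (\<lambda>x. x N)" if "N \<in> I" for N
    unfolding P_def using that by (rule continuous_map_product_projection)
  \<comment> \<open>This is the equaliser of two continuous maps into a Hausdorff space. With the
    discrete topology on \<open>UNIV\<close> as target, continuity needs no information on the range
    of \<open>\<phi> N M\<close>.\<close>
  have "closedin P {x \<in> topspace P. \<phi> N M (x N) = x M}" if "N \<in> I" "M \<in> I" for N M
  proof (rule closedin_continuous_maps_eq[where Y = "discrete_topology UNIV"])
    show "continuous_map P (discrete_topology UNIV) (\<lambda>x. \<phi> N M (x N))"
      using continuous_map_compose[OF proj[OF that(1)], of "discrete_topology UNIV" "\<phi> N M"]
      by (simp add: o_def)
    show "continuous_map P (discrete_topology UNIV) (\<lambda>x. x M)"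
      using continuous_map_compose[OF proj[OF that(2)], of "discrete_topology UNIV" id]
      by (simp add: o_def)
  qed simp
  then have "closedin P L"
    unfolding L by (intro closedin_Inter) auto
  then show "compact_space (completed_group_algebra_topology k G T)"
    using \<open>compact_space P\<close> closedin_compact_space compact_space_subtopology
    unfolding completed_group_algebra_topology_def P_def L_def A_def I_def by blast
  show "topspace (completed_group_algebra_topology k G T) = carrier (completed_group_algebra k G T)"
    using closedin_subset[OF \<open>closedin P L\<close>]
    unfolding completed_group_algebra_topology_def P_def L_def A_def I_def
    by (simp only: topspace_subtopology Int_absorb1)
qed

section \<open>The endomorphism ring of a profinite module\<close>

context profinite_module
begin

abbreviation "End \<equiv> endomorphism_ring R M TM"

lemma topspace_TM: "topspace TM = carrier M"
  using additive.topspace_eq by simp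

lemma continuous_map_add:
  assumes "continuous_map S TM f" and "continuous_map S TM g"
  shows "continuous_map S TM (\<lambda>x. f x \<oplus>\<^bsub>M\<^esub> g x)"
  using additive.continuous_map_mult[OF assms] by simp

lemma continuous_map_neg:
  assumes "continuous_map S TM f"
  shows "continuous_map S TM (\<lambda>x. \<ominus>\<^bsub>M\<^esub> f x)"
  using continuous_map_compose[OF assms additive.continuous_inv] by (simp add: o_def a_inv_def)

lemma smult_zero:
  assumes "a \<in> carrier R"
  shows "a \<odot>\<^bsub>M\<^esub> \<zero>\<^bsub>M\<^esub> = \<zero>\<^bsub>M\<^esub>"
  using smult_r_distr[OF assms M.zero_closed M.zero_closed] assms
  by (simp add: M.add.r_cancel_one')

lemma smult_neg:
  assumes "a \<in> carrier R" and "x \<in> carrier M"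
  shows "a \<odot>\<^bsub>M\<^esub> (\<ominus>\<^bsub>M\<^esub> x) = \<ominus>\<^bsub>M\<^esub> (a \<odot>\<^bsub>M\<^esub> x)"
proof -
  have "a \<odot>\<^bsub>M\<^esub> (\<ominus>\<^bsub>M\<^esub> x) \<oplus>\<^bsub>M\<^esub> a \<odot>\<^bsub>M\<^esub> x = \<zero>\<^bsub>M\<^esub>"
    using smult_r_distr[of a "\<ominus>\<^bsub>M\<^esub> x" x] assms by (simp add: M.l_neg smult_zero)
  then show ?thesis using M.minus_equality assms by simp
qed

lemma End_iff:
  "f \<in> carrier End \<longleftrightarrow> f \<in> extensional (carrier M) \<and> (\<forall>x\<in>carrier M. f x \<in> carrier M) \<and>
    (\<forall>x\<in>carrier M. \<forall>y\<in>carrier M. f (x \<oplus>\<^bsub>M\<^esub> y) = f x \<oplus>\<^bsub>M\<^esub> f y) \<and>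
    (\<forall>a\<in>carrier R. \<forall>x\<in>carrier M. f (a \<odot>\<^bsub>M\<^esub> x) = a \<odot>\<^bsub>M\<^esub> f x) \<and>
    continuous_map TM TM f"
  by (auto simp: endomorphism_ring_def PiE_def)

text \<open>Endomorphisms are encoded as extensional functions, so a formula has to be cut down to
  \<open>carrier M\<close> before it is an element of the ring.\<close>

lemma restrict_in_End:
  assumes "\<And>x. x \<in> carrier M \<Longrightarrow> f x \<in> carrier M"
    and "\<And>x y. x \<in> carrier M \<Longrightarrow> y \<in> carrier M \<Longrightarrow> f (x \<oplus>\<^bsub>M\<^esub> y) = f x \<oplus>\<^bsub>M\<^esub> f y"
    and "\<And>a x. a \<in> carrier R \<Longrightarrow> x \<in> carrier M \<Longrightarrow> f (a \<odot>\<^bsub>M\<^esub> x) = a \<odot>\<^bsub>M\<^esub> f x"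
    and "continuous_map TM TM f"
  shows "(\<lambda>x\<in>carrier M. f x) \<in> carrier End"
proof -
  have "continuous_map TM TM (\<lambda>x\<in>carrier M. f x)"
    by (rule continuous_map_eq[OF assms(4)]) (simp add: topspace_TM)
  then show ?thesis
    unfolding End_iff using assms(1-3) by simp
qed

lemma End_closed [simp]: "f \<in> carrier End \<Longrightarrow> x \<in> carrier M \<Longrightarrow> f x \<in> carrier M"
  by (simp add: End_iff)

lemma End_add: "f \<in> carrier End \<Longrightarrow> x \<in> carrier M \<Longrightarrow> y \<in> carrier M \<Longrightarrow> f (x \<oplus>\<^bsub>M\<^esub> y) = f x \<oplus>\<^bsub>M\<^esub> f y"
  by (simp add: End_iff)

lemma End_smult: "f \<in> carrier End \<Longrightarrow> a \<in> carrier R \<Longrightarrow> x \<in> carrier M \<Longrightarrow> f (a \<odot>\<^bsub>M\<^esub> x) = a \<odot>\<^bsub>M\<^esub> f x"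
  by (simp add: End_iff)

lemma End_continuous: "f \<in> carrier End \<Longrightarrow> continuous_map TM TM f"
  by (simp add: End_iff)

lemma End_zero: "f \<in> carrier End \<Longrightarrow> f \<zero>\<^bsub>M\<^esub> = \<zero>\<^bsub>M\<^esub>"
  using End_add[of f "\<zero>\<^bsub>M\<^esub>" "\<zero>\<^bsub>M\<^esub>"] by (simp add: M.add.r_cancel_one')

lemma End_neg:
  assumes "f \<in> carrier End" and "x \<in> carrier M"
  shows "f (\<ominus>\<^bsub>M\<^esub> x) = \<ominus>\<^bsub>M\<^esub> f x"
proof -
  have "f (\<ominus>\<^bsub>M\<^esub> x) \<oplus>\<^bsub>M\<^esub> f x = \<zero>\<^bsub>M\<^esub>"
    using End_add[of f "\<ominus>\<^bsub>M\<^esub> x" x] assms by (simp add: M.l_neg End_zero)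
  then show ?thesis using M.minus_equality assms by simp
qed

lemma End_minus:
  assumes "f \<in> carrier End" and "x \<in> carrier M" and "y \<in> carrier M"
  shows "f (x \<ominus>\<^bsub>M\<^esub> y) = f x \<ominus>\<^bsub>M\<^esub> f y"
  using assms by (simp add: M.minus_eq End_add End_neg)

lemma End_eqI:
  assumes "f \<in> carrier End" and "g \<in> carrier End" and "\<And>x. x \<in> carrier M \<Longrightarrow> f x = g x"
  shows "f = g"
  using assms by (intro extensionalityI[of f "carrier M"]) (auto simp: End_iff)

lemma one_End_apply [simp]: "x \<in> carrier M \<Longrightarrow> \<one>\<^bsub>End\<^esub> x = x"
  by (simp add: endomorphism_ring_def)

lemma zero_End_apply [simp]: "x \<in> carrier M \<Longrightarrow> \<zero>\<^bsub>End\<^esub> x = \<zero>\<^bsub>M\<^esub>"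
  by (simp add: endomorphism_ring_def)

lemma mult_End_apply [simp]: "x \<in> carrier M \<Longrightarrow> (f \<otimes>\<^bsub>End\<^esub> g) x = f (g x)"
  by (simp add: endomorphism_ring_def)

lemma add_End_apply [simp]: "x \<in> carrier M \<Longrightarrow> (f \<oplus>\<^bsub>End\<^esub> g) x = f x \<oplus>\<^bsub>M\<^esub> g x"
  by (simp add: endomorphism_ring_def)

lemma one_End_closed: "\<one>\<^bsub>End\<^esub> \<in> carrier End"
proof -
  have "\<one>\<^bsub>End\<^esub> = (\<lambda>x\<in>carrier M. x)" by (simp add: endomorphism_ring_def)
  then show ?thesis using restrict_in_End[of "\<lambda>x. x"] by simp
qed

lemma zero_End_closed: "\<zero>\<^bsub>End\<^esub> \<in> carrier End"
proof -
  have "\<zero>\<^bsub>End\<^esub> = (\<lambda>x\<in>carrier M. \<zero>\<^bsub>M\<^esub>)" by (simp add: endomorphism_ring_def)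
  then show ?thesis
    using restrict_in_End[of "\<lambda>x. \<zero>\<^bsub>M\<^esub>"] by (simp add: smult_zero topspace_TM)
qed

lemma mult_End_closed:
  assumes f: "f \<in> carrier End" and g: "g \<in> carrier End"
  shows "f \<otimes>\<^bsub>End\<^esub> g \<in> carrier End"
proof -
  have "f \<otimes>\<^bsub>End\<^esub> g = (\<lambda>x\<in>carrier M. f (g x))" by (simp add: endomorphism_ring_def)
  moreover have "continuous_map TM TM (\<lambda>x. f (g x))"
    using continuous_map_compose[OF End_continuous[OF g] End_continuous[OF f]] by (simp add: o_def)
  ultimately show ?thesis
    using f g restrict_in_End[of "\<lambda>x. f (g x)"] by (simp add: End_add End_smult)
qed

lemma add_End_closed:
  assumes f: "f \<in> carrier End" and g: "g \<in> carrier End"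
  shows "f \<oplus>\<^bsub>End\<^esub> g \<in> carrier End"
proof -
  have "f \<oplus>\<^bsub>End\<^esub> g = (\<lambda>x\<in>carrier M. f x \<oplus>\<^bsub>M\<^esub> g x)" by (simp add: endomorphism_ring_def)
  then show ?thesis
    using f g restrict_in_End[of "\<lambda>x. f x \<oplus>\<^bsub>M\<^esub> g x"]
      continuous_map_add[OF End_continuous[OF f] End_continuous[OF g]]
    by (simp add: End_add End_smult smult_r_distr M.a_ac)
qed

lemma neg_End_closed:
  assumes f: "f \<in> carrier End"
  shows "(\<lambda>x\<in>carrier M. \<ominus>\<^bsub>M\<^esub> f x) \<in> carrier End"
  using f restrict_in_End[of "\<lambda>x. \<ominus>\<^bsub>M\<^esub> f x"] continuous_map_neg[OF End_continuous[OF f]]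
  by (simp add: End_add End_smult smult_neg M.minus_add)

lemma ring_End: "ring End"
proof (rule ringI)
  show "abelian_group End"
  proof (rule abelian_groupI)
    fix f g h assume fgh: "f \<in> carrier End" "g \<in> carrier End" "h \<in> carrier End"
    show "f \<oplus>\<^bsub>End\<^esub> g \<oplus>\<^bsub>End\<^esub> h = f \<oplus>\<^bsub>End\<^esub> (g \<oplus>\<^bsub>End\<^esub> h)"
      using fgh by (intro End_eqI add_End_closed) (simp_all add: M.a_assoc)
  next
    fix f g assume "f \<in> carrier End" "g \<in> carrier End"
    then show "f \<oplus>\<^bsub>End\<^esub> g = g \<oplus>\<^bsub>End\<^esub> f"
      by (intro End_eqI add_End_closed) (simp_all add: M.a_comm)
  next
    fix f assume f: "f \<in> carrier End"
    then show "\<zero>\<^bsub>End\<^esub> \<oplus>\<^bsub>End\<^esub> f = f"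
      by (intro End_eqI add_End_closed zero_End_closed) simp_all
    have "(\<lambda>x\<in>carrier M. \<ominus>\<^bsub>M\<^esub> f x) \<oplus>\<^bsub>End\<^esub> f = \<zero>\<^bsub>End\<^esub>"
      using f by (intro End_eqI add_End_closed zero_End_closed neg_End_closed) (simp_all add: M.l_neg)
    then show "\<exists>g\<in>carrier End. g \<oplus>\<^bsub>End\<^esub> f = \<zero>\<^bsub>End\<^esub>"
      using neg_End_closed[OF f] by (rule bexI)
  qed (auto intro: add_End_closed zero_End_closed)
  show "monoid End"
  proof (rule monoidI)
    fix f g h assume "f \<in> carrier End" "g \<in> carrier End" "h \<in> carrier End"
    then show "f \<otimes>\<^bsub>End\<^esub> g \<otimes>\<^bsub>End\<^esub> h = f \<otimes>\<^bsub>End\<^esub> (g \<otimes>\<^bsub>End\<^esub> h)"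
      by (intro End_eqI mult_End_closed) simp_all
  next
    fix f assume "f \<in> carrier End"
    then show "\<one>\<^bsub>End\<^esub> \<otimes>\<^bsub>End\<^esub> f = f" "f \<otimes>\<^bsub>End\<^esub> \<one>\<^bsub>End\<^esub> = f"
      by (intro End_eqI mult_End_closed one_End_closed; simp)+
  qed (auto intro: mult_End_closed one_End_closed)
next
  fix f g h assume "f \<in> carrier End" "g \<in> carrier End" "h \<in> carrier End"
  then show "(f \<oplus>\<^bsub>End\<^esub> g) \<otimes>\<^bsub>End\<^esub> h = f \<otimes>\<^bsub>End\<^esub> h \<oplus>\<^bsub>End\<^esub> g \<otimes>\<^bsub>End\<^esub> h"
    "h \<otimes>\<^bsub>End\<^esub> (f \<oplus>\<^bsub>End\<^esub> g) = h \<otimes>\<^bsub>End\<^esub> f \<oplus>\<^bsub>End\<^esub> h \<otimes>\<^bsub>End\<^esub> g"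
    by (intro End_eqI mult_End_closed add_End_closed; simp add: End_add)+
qed

end

sublocale profinite_module \<subseteq> End: ring "endomorphism_ring R M TM"
  by (rule ring_End)

section \<open>Differences, powers and units in the endomorphism ring\<close>

context profinite_module
begin

text \<open>The record of the ring has no field for negation, so the value of the additive inverse
  is recovered from the sum with g being zero.\<close>

lemma minus_End_apply [simp]:
  assumes f: "f \<in> carrier End" and g: "g \<in> carrier End" and x: "x \<in> carrier M"
  shows "(f \<ominus>\<^bsub>End\<^esub> g) x = f x \<ominus>\<^bsub>M\<^esub> g x"
proof -
  have "(\<ominus>\<^bsub>End\<^esub> g) x \<oplus>\<^bsub>M\<^esub> g x = (\<ominus>\<^bsub>End\<^esub> g \<oplus>\<^bsub>End\<^esub> g) x"
    using x by simp
  also have "\<dots> = \<zero>\<^bsub>M\<^esub>" using g x by (simp add: End.l_neg del: add_End_apply)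
  finally have "(\<ominus>\<^bsub>End\<^esub> g) x = \<ominus>\<^bsub>M\<^esub> g x"
    using g x M.minus_equality[of "(\<ominus>\<^bsub>End\<^esub> g) x" "g x"] by simp
  then show ?thesis using x by (simp add: End.minus_eq M.minus_eq)
qed

lemma pow_End_add:
  assumes "f \<in> carrier End" and "x \<in> carrier M"
  shows "(f [^]\<^bsub>End\<^esub> (m + n :: nat)) x = (f [^]\<^bsub>End\<^esub> m) ((f [^]\<^bsub>End\<^esub> n) x)"
  using assms by (simp flip: End.nat_pow_mult)

text \<open>A continuous bijection of a compact Hausdorff space is a homeomorphism, so the inverse
  map is continuous; its linearity follows by applying the injective f.\<close>

lemma bijective_End_is_unit:
  assumes f: "f \<in> carrier End" and bij: "bij_betw f (carrier M) (carrier M)"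
  shows "f \<in> Units End"
proof -
  define g where "g = (\<lambda>x\<in>carrier M. inv_into (carrier M) f x)"
  have inj: "inj_on f (carrier M)" and surj: "f ` carrier M = carrier M"
    using bij by (auto simp: bij_betw_def)
  have gM: "g x \<in> carrier M" and fg: "f (g x) = x" if "x \<in> carrier M" for x
    using that surj inv_into_into[of x f "carrier M"] f_inv_into_f[of x f "carrier M"]
    by (auto simp: g_def)
  have gf: "g (f x) = x" if "x \<in> carrier M" for x
    using that f inj by (simp add: g_def)
  have closed: "closed_map TM TM f"
    using continuous_imp_closed_map[OF End_continuous[OF f]] additive.compact additive.Hausdorff by blast
  have "homeomorphic_map TM TM f"
    using bijective_closed_imp_homeomorphic_map[OF End_continuous[OF f] closed] inj surj
    by (simp add: topspace_TM)
  then obtain h where h: "continuous_map TM TM h" "\<forall>x\<in>topspace TM. h (f x) = x"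
    unfolding homeomorphic_map_maps homeomorphic_maps_def by blast
  \<comment> \<open>The topological inverse h is continuous but not known to be extensional; g is
    the extensional map agreeing with it on the module.\<close>
  have "continuous_map TM TM g"
  proof (rule continuous_map_eq[OF h(1)])
    fix x assume "x \<in> topspace TM"
    then have x: "x \<in> carrier M" by (simp add: topspace_TM)
    then have "h (f (g x)) = g x" using h(2) gM by (simp add: topspace_TM)
    then show "h x = g x" using x by (simp add: fg)
  qed
  moreover have "g (x \<oplus>\<^bsub>M\<^esub> y) = g x \<oplus>\<^bsub>M\<^esub> g y" if "x \<in> carrier M" "y \<in> carrier M" for x y
  proof -
    have "f (g x \<oplus>\<^bsub>M\<^esub> g y) = x \<oplus>\<^bsub>M\<^esub> y" using that f by (simp add: End_add gM fg)
    then show ?thesis using gf[of "g x \<oplus>\<^bsub>M\<^esub> g y"] that gM by simp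
  qed
  moreover have "g (a \<odot>\<^bsub>M\<^esub> x) = a \<odot>\<^bsub>M\<^esub> g x" if "a \<in> carrier R" "x \<in> carrier M" for a x
  proof -
    have "f (a \<odot>\<^bsub>M\<^esub> g x) = a \<odot>\<^bsub>M\<^esub> x" using that f by (simp add: End_smult gM fg)
    then show ?thesis using gf[of "a \<odot>\<^bsub>M\<^esub> g x"] that gM by simp
  qed
  ultimately have g: "g \<in> carrier End"
    unfolding End_iff using gM by (auto simp: g_def)
  have "g \<otimes>\<^bsub>End\<^esub> f = \<one>\<^bsub>End\<^esub>" "f \<otimes>\<^bsub>End\<^esub> g = \<one>\<^bsub>End\<^esub>"
    using f g by (intro End_eqI; simp add: fg gf)+
  then show ?thesis using f g unfolding Units_def by blast
qed

end

section \<open>Open fully invariant submodules\<close>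

text \<open>On A the map h factors through g, by choosing preimages with
  \<open>inv_into\<close>.\<close>

lemma finite_image_factor:
  assumes "finite (g ` A)" and "\<And>x y. x \<in> A \<Longrightarrow> y \<in> A \<Longrightarrow> g x = g y \<Longrightarrow> h x = h y"
  shows "finite (h ` A)"
proof -
  have "h x = h (inv_into A g (g x))" if "x \<in> A" for x
    using that assms(2)[OF that inv_into_into[of "g x" g A]] f_inv_into_f[of "g x" g A] by simp
  then have "h ` A \<subseteq> (\<lambda>z. h (inv_into A g z)) ` (g ` A)" by auto
  then show ?thesis using assms(1) by (rule finite_subset[OF _ finite_imageI])
qed

section \<open>Submodules and congruences modulo them\<close>

context profinite_module
begin

lemma minus_zero_eq: "\<ominus>\<^bsub>M\<^esub> \<zero>\<^bsub>M\<^esub> = \<zero>\<^bsub>M\<^esub>"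
  using M.minus_equality[of "\<zero>\<^bsub>M\<^esub>" "\<zero>\<^bsub>M\<^esub>"] by simp

lemma submodule_carrier: "submodule V R M \<Longrightarrow> x \<in> V \<Longrightarrow> x \<in> carrier M"
  using subgroup.mem_carrier[of V "add_monoid M" x] by (simp add: submodule_def)

lemma submodule_zero: "submodule V R M \<Longrightarrow> \<zero>\<^bsub>M\<^esub> \<in> V"
  using subgroup.one_closed[of V "add_monoid M"] by (simp add: submodule_def)

lemma submodule_add: "submodule V R M \<Longrightarrow> x \<in> V \<Longrightarrow> y \<in> V \<Longrightarrow> x \<oplus>\<^bsub>M\<^esub> y \<in> V"
  using subgroup.m_closed[of V "add_monoid M" x y] by (simp add: submodule_def)

lemma submodule_neg: "submodule V R M \<Longrightarrow> x \<in> V \<Longrightarrow> \<ominus>\<^bsub>M\<^esub> x \<in> V"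
  using subgroup.m_inv_closed[of V "add_monoid M" x] by (simp add: submodule_def a_inv_def)

text \<open>Congruence modulo V is expressed by differences instead of a quotient module; this and
  the next two lemmas give the rules for computing with it.\<close>

lemma submodule_minus_sym:
  assumes "submodule V R M" and "x \<in> carrier M" and "y \<in> carrier M" and "x \<ominus>\<^bsub>M\<^esub> y \<in> V"
  shows "y \<ominus>\<^bsub>M\<^esub> x \<in> V"
proof -
  have "\<ominus>\<^bsub>M\<^esub> (x \<ominus>\<^bsub>M\<^esub> y) = y \<ominus>\<^bsub>M\<^esub> x"
    using assms(2,3) by (simp add: M.minus_eq M.minus_add M.a_comm)
  then show ?thesis using submodule_neg[OF assms(1,4)] by simp
qed

lemma submodule_minus_trans:
  assumes "submodule V R M" and "x \<in> carrier M" and "y \<in> carrier M" and "z \<in> carrier M"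
    and "x \<ominus>\<^bsub>M\<^esub> y \<in> V" and "y \<ominus>\<^bsub>M\<^esub> z \<in> V"
  shows "x \<ominus>\<^bsub>M\<^esub> z \<in> V"
proof -
  have "(x \<ominus>\<^bsub>M\<^esub> y) \<oplus>\<^bsub>M\<^esub> (y \<ominus>\<^bsub>M\<^esub> z) = x \<ominus>\<^bsub>M\<^esub> z"
    using assms(2-4) by (simp add: M.minus_eq M.a_assoc M.r_neg1)
  then show ?thesis using submodule_add[OF assms(1,5,6)] by simp
qed

lemma submodule_mem_cong:
  assumes "submodule V R M" and "x \<in> carrier M" and "y \<in> V" and "x \<ominus>\<^bsub>M\<^esub> y \<in> V"
  shows "x \<in> V"
proof -
  have "(x \<ominus>\<^bsub>M\<^esub> y) \<oplus>\<^bsub>M\<^esub> y = x"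
    using assms(2) submodule_carrier[OF assms(1,3)] by (simp add: M.minus_eq M.a_assoc M.l_neg)
  then show ?thesis using submodule_add[OF assms(1,4,3)] by simp
qed

lemma submoduleI:
  assumes "V \<subseteq> carrier M" and "\<zero>\<^bsub>M\<^esub> \<in> V"
    and "\<And>x y. x \<in> V \<Longrightarrow> y \<in> V \<Longrightarrow> x \<oplus>\<^bsub>M\<^esub> y \<in> V"
    and "\<And>x. x \<in> V \<Longrightarrow> \<ominus>\<^bsub>M\<^esub> x \<in> V"
    and "\<And>a x. a \<in> carrier R \<Longrightarrow> x \<in> V \<Longrightarrow> a \<odot>\<^bsub>M\<^esub> x \<in> V"
  shows "submodule V R M"
proof (intro submodule.intro submodule_axioms.intro)
  have "V \<noteq> {}" using assms(2) by auto
  then show "subgroup V (add_monoid M)"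
    using assms(1,3,4) by (intro M.add.subgroupI) auto
qed (rule assms(5))

lemma submodule_Inter:
  assumes "\<And>V. V \<in> \<V> \<Longrightarrow> submodule V R M" and "\<V> \<noteq> {}"
  shows "submodule (\<Inter>\<V>) R M"
proof (rule submoduleI)
  obtain V where "V \<in> \<V>" using assms(2) by blast
  then show "\<Inter>\<V> \<subseteq> carrier M" using submodule_carrier[OF assms(1)] by blast
next
  show "a \<odot>\<^bsub>M\<^esub> x \<in> \<Inter>\<V>" if "a \<in> carrier R" "x \<in> \<Inter>\<V>" for a x
    using that submodule.smult_closed[OF assms(1)] by blast
qed (auto intro: submodule_zero submodule_add submodule_neg assms(1))

lemma submodule_preimage:
  assumes f: "f \<in> carrier End" and V: "submodule V R M"
  shows "submodule {x \<in> carrier M. f x \<in> V} R M"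
  using f submodule_zero[OF V] submodule_add[OF V] submodule_neg[OF V] submodule.smult_closed[OF V]
  by (intro submoduleI) (auto simp: End_zero End_add End_neg End_smult)

lemma openin_preimage:
  "f \<in> carrier End \<Longrightarrow> openin TM V \<Longrightarrow> openin TM {x \<in> carrier M. f x \<in> V}"
  using openin_continuous_map_preimage[OF End_continuous] by (simp add: topspace_TM)

lemma closedin_preimage:
  "f \<in> carrier End \<Longrightarrow> closedin TM V \<Longrightarrow> closedin TM {x \<in> carrier M. f x \<in> V}"
  using closedin_continuous_map_preimage[OF End_continuous] by (simp add: topspace_TM)

lemma closedin_open_submodule:
  "submodule V R M \<Longrightarrow> openin TM V \<Longrightarrow> closedin TM V"
  using additive.closedin_open_subgroup by (simp add: submodule_def)

text \<open>The open fully invariant submodules. Invariance lets every endomorphism act on the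
  finite quotient by W, so congruences modulo W may be mapped forward.\<close>

definition invariant_nbhds :: "'m set set" where
  "invariant_nbhds = {W. submodule W R M \<and> openin TM W \<and> (\<forall>f\<in>carrier End. \<forall>x\<in>W. f x \<in> W)}"

lemma invariant_nbhdsD:
  assumes "W \<in> invariant_nbhds"
  shows "submodule W R M" and "openin TM W" and "closedin TM W"
    and "\<And>f x. f \<in> carrier End \<Longrightarrow> x \<in> W \<Longrightarrow> f x \<in> W"
  using assms closedin_open_submodule[of W] by (simp_all add: invariant_nbhds_def)

text \<open>Makes the family directed downwards, as the finite intersection argument for the Fitting
  decomposition requires.\<close>

lemma invariant_nbhds_Inter:
  assumes "finite F" and "F \<noteq> {}" and "F \<subseteq> invariant_nbhds"
  shows "\<Inter>F \<in> invariant_nbhds"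
proof -
  have W: "W \<in> invariant_nbhds" if "W \<in> F" for W using that assms(3) by blast
  have "openin TM (\<Inter>F)"
    using assms(1,2) invariant_nbhdsD(2)[OF W] by (intro openin_Inter) auto
  moreover have "submodule (\<Inter>F) R M"
    using assms(2) invariant_nbhdsD(1)[OF W] by (intro submodule_Inter) auto
  ultimately show ?thesis
    unfolding invariant_nbhds_def using invariant_nbhdsD(4)[OF W] by auto
qed

lemma carrier_in_invariant_nbhds: "carrier M \<in> invariant_nbhds"
proof -
  have "submodule (carrier M) R M" by (intro submoduleI) auto
  then show ?thesis
    unfolding invariant_nbhds_def using openin_topspace[of TM] by (simp add: topspace_TM)
qed

end

text \<open>Isolates what the Fitting argument uses of the scalars: a compact topology on the whole
  ring. For k[[G]] this is \<open>compact_space_completed_group_algebra\<close>.\<close>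

locale fg_profinite_module = profinite_module R TR M TM
  for R :: "('r, 'a) ring_scheme" (structure) and TR :: "'r topology"
    and M :: "('r, 'm, 'b) module_scheme" (structure) and TM :: "'m topology" +
  assumes compact_scalars: "compact_space TR"
    and topspace_scalars: "topspace TR = carrier R"
    and finitely_generated: "finitely_generated R M TM"
begin

text \<open>Inside an open subgroup H, the elements with all scalar multiples in H form the largest
  submodule. It is open by the tube lemma, as the scalars are compact.\<close>

lemma open_submodule_nbhd:
  assumes "openin TM B" and "\<zero>\<^bsub>M\<^esub> \<in> B"
  obtains V where "submodule V R M" and "openin TM V" and "V \<subseteq> B"
proof -
  obtain H where H: "subgroup H (add_monoid M)" "openin TM H" "H \<subseteq> B"
    using additive.open_subgroup_nbhd[of B] assms by auto
  have H_add: "x \<oplus>\<^bsub>M\<^esub> y \<in> H" if "x \<in> H" "y \<in> H" for x y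
    using subgroup.m_closed[OF H(1) that] by simp
  have H_neg: "\<ominus>\<^bsub>M\<^esub> x \<in> H" if "x \<in> H" for x
    using subgroup.m_inv_closed[OF H(1) that] by (simp add: a_inv_def)
  have H_zero: "\<zero>\<^bsub>M\<^esub> \<in> H"
    using subgroup.one_closed[OF H(1)] by simp
  define V where "V = {x \<in> carrier M. \<forall>a\<in>carrier R. a \<odot>\<^bsub>M\<^esub> x \<in> H}"
  have "openin TM V"
    using openin_forall_compact[OF compact_scalars continuous_smult H(2)]
    by (simp add: V_def topspace_scalars topspace_TM)
  moreover have "submodule V R M"
    by (rule submoduleI)
      (auto simp: V_def smult_zero smult_neg smult_r_distr smult_assoc[symmetric] H_zero H_add H_neg)
  moreover have "x \<in> H" if "x \<in> V" for x
  proof -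
    have "\<one> \<odot>\<^bsub>M\<^esub> x \<in> H" using that R.one_closed unfolding V_def by blast
    then show ?thesis using that by (simp add: V_def)
  qed
  then have "V \<subseteq> B" using H(3) by blast
  ultimately show thesis using that by blast
qed

text \<open>The invariant \<open>\<kappa> f\<close> records the cosets of the images of the
  generators. It has finitely many values because V has finite index, and it determines f modulo
  V.\<close>

lemma finite_End_mod:
  assumes V: "submodule V R M" "openin TM V"
  shows "\<exists>\<kappa> :: ('m \<Rightarrow> 'm) \<Rightarrow> 'm \<Rightarrow> 'm set. finite (\<kappa> ` carrier End) \<and>
    (\<forall>f\<in>carrier End. \<forall>g\<in>carrier End. \<kappa> f = \<kappa> g \<longrightarrow> (\<forall>x\<in>carrier M. f x \<ominus>\<^bsub>M\<^esub> g x \<in> V))"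
proof -
  obtain S where S: "finite S" "S \<subseteq> carrier M"
    and gen: "\<And>V. profinite_submodule R M TM V \<Longrightarrow> S \<subseteq> V \<Longrightarrow> V = carrier M"
    using finitely_generated unfolding finitely_generated_def by (elim exE conjE) simp
  have sub: "subgroup V (add_monoid M)" using V(1) by (simp add: submodule_def)
  define \<kappa> where "\<kappa> f = (\<lambda>s\<in>S. V #>\<^bsub>add_monoid M\<^esub> f s)" for f :: "'m \<Rightarrow> 'm"
  have "finite (rcosets\<^bsub>add_monoid M\<^esub> V)"
    using additive.finite_rcosets_open_subgroup[OF additive.compact sub V(2)] .
  then have "finite (S \<rightarrow>\<^sub>E rcosets\<^bsub>add_monoid M\<^esub> V)"
    using S(1) by (intro finite_PiE) auto
  moreover have "\<kappa> f \<in> S \<rightarrow>\<^sub>E rcosets\<^bsub>add_monoid M\<^esub> V" if "f \<in> carrier End" for f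
    unfolding \<kappa>_def using that S(2) subgroup.subset[OF sub]
    by (intro restrict_PiE_iff[THEN iffD2] ballI group.rcosetsI[OF M.a_group]) auto
  then have "\<kappa> ` carrier End \<subseteq> S \<rightarrow>\<^sub>E rcosets\<^bsub>add_monoid M\<^esub> V" by (rule image_subsetI)
  ultimately have "finite (\<kappa> ` carrier End)" by (rule rev_finite_subset)
  moreover have "f x \<ominus>\<^bsub>M\<^esub> g x \<in> V"
    if f: "f \<in> carrier End" and g: "g \<in> carrier End" and eq: "\<kappa> f = \<kappa> g" and x: "x \<in> carrier M"
    for f g x
  proof -
    let ?P = "{x \<in> carrier M. (f \<ominus>\<^bsub>End\<^esub> g) x \<in> V}"
    have fg: "f \<ominus>\<^bsub>End\<^esub> g \<in> carrier End" using f g by simp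
    \<comment> \<open>The generators generate only topologically, so the locus of agreement modulo V
      must also be closed; it is, because an open submodule is closed.\<close>
    have "profinite_submodule R M TM ?P"
      unfolding profinite_submodule_def
      using submodule_preimage[OF fg V(1)] closedin_preimage[OF fg closedin_open_submodule[OF V]] by blast
    moreover have "s \<in> ?P" if s: "s \<in> S" for s
    proof -
      have sM: "s \<in> carrier M" using s S(2) by blast
      have "V #>\<^bsub>add_monoid M\<^esub> f s = V #>\<^bsub>add_monoid M\<^esub> g s"
        using fun_cong[OF eq, of s] s by (simp add: \<kappa>_def)
      then have "f s \<in> V #>\<^bsub>add_monoid M\<^esub> g s"
        using group.rcos_self[OF M.a_group _ sub, of "f s"] f sM by simp
      then have "f s \<otimes>\<^bsub>add_monoid M\<^esub> inv\<^bsub>add_monoid M\<^esub> g s \<in> V"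
        using subgroup.rcos_module_imp[OF sub M.a_group, of "g s"] g sM by simp
      then show ?thesis using f g sM by (simp add: M.minus_eq a_inv_def)
    qed
    then have "S \<subseteq> ?P" by (rule subsetI)
    ultimately have "?P = carrier M" by (rule gen)
    then have "x \<in> ?P" using x by simp
    then show ?thesis using minus_End_apply[OF f g x] by simp
  qed
  ultimately show ?thesis by (intro exI[of _ \<kappa>] conjI ballI impI)
qed

text \<open>The preimage of V under f depends only on f modulo V, so finitely many preimages occur
  and their intersection W is open. Closure of the endomorphisms under composition makes W
  invariant, and the identity puts W inside V.\<close>

lemma invariant_nbhd_in_open:
  assumes "openin TM B" and "\<zero>\<^bsub>M\<^esub> \<in> B"
  obtains W where "W \<in> invariant_nbhds" and "W \<subseteq> B"
proof -
  obtain V where V: "submodule V R M" "openin TM V" "V \<subseteq> B"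
    using open_submodule_nbhd[OF assms] .
  obtain \<kappa> :: "('m \<Rightarrow> 'm) \<Rightarrow> 'm \<Rightarrow> 'm set" where \<kappa>: "finite (\<kappa> ` carrier End)"
    "\<forall>f\<in>carrier End. \<forall>g\<in>carrier End. \<kappa> f = \<kappa> g \<longrightarrow> (\<forall>x\<in>carrier M. f x \<ominus>\<^bsub>M\<^esub> g x \<in> V)"
    using finite_End_mod[OF V(1,2)] by (elim exE conjE)
  define pre where "pre f = {x \<in> carrier M. f x \<in> V}" for f :: "'m \<Rightarrow> 'm"
  have "pre f \<subseteq> pre g" if f: "f \<in> carrier End" and g: "g \<in> carrier End" and eq: "\<kappa> f = \<kappa> g" for f g
    unfolding pre_def
    using submodule_mem_cong[OF V(1) End_closed[OF g] _ \<kappa>(2)[rule_format, OF g f eq[symmetric]]] by blast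
  then have "pre f = pre g" if "f \<in> carrier End" "g \<in> carrier End" "\<kappa> f = \<kappa> g" for f g
    using that by (intro equalityI) simp_all
  with \<kappa>(1) have fin: "finite (pre ` carrier End)" by (rule finite_image_factor)
  define W where "W = \<Inter>(pre ` carrier End)"
  have "openin TM W"
    unfolding W_def using fin End.one_closed
    by (intro openin_Inter) (auto simp: pre_def intro: openin_preimage V(2))
  moreover have "submodule W R M"
    unfolding W_def using End.one_closed
    by (intro submodule_Inter) (auto simp: pre_def intro: submodule_preimage V(1))
  moreover have "f x \<in> W" if f: "f \<in> carrier End" and x: "x \<in> W" for f x
  proof -
    have xM: "x \<in> carrier M" using x End.one_closed unfolding W_def pre_def by blast
    have "f x \<in> pre g" if g: "g \<in> carrier End" for g
    proof -
      have "x \<in> pre (g \<otimes>\<^bsub>End\<^esub> f)"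
        using x End.m_closed[OF g f] unfolding W_def by blast
      then show ?thesis using f xM by (simp add: pre_def)
    qed
    then show ?thesis unfolding W_def by blast
  qed
  ultimately have "W \<in> invariant_nbhds" by (simp add: invariant_nbhds_def)
  moreover have "W \<subseteq> pre \<one>\<^bsub>End\<^esub>" unfolding W_def using End.one_closed by blast
  moreover have "pre \<one>\<^bsub>End\<^esub> \<subseteq> V" by (auto simp: pre_def)
  ultimately have "W \<in> invariant_nbhds" "W \<subseteq> B" using V(3) by simp_all
  then show thesis by (rule that)
qed

text \<open>If x were outside C, continuity of z \<mapsto> x - z at 0 would give a W with x - W
  disjoint from C. But an approximating c equals x - (x - c).\<close>

lemma mem_closed_if_approximable:
  assumes "closedin TM C" and x: "x \<in> carrier M"
    and approx: "\<And>W. W \<in> invariant_nbhds \<Longrightarrow> \<exists>c\<in>C. x \<ominus>\<^bsub>M\<^esub> c \<in> W"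
  shows "x \<in> C"
proof (rule ccontr)
  assume "x \<notin> C"
  have CM: "C \<subseteq> carrier M" using closedin_subset[OF assms(1)] by (simp add: topspace_TM)
  have "openin TM (carrier M - C)"
    using openin_diff[OF openin_topspace assms(1)] by (simp add: topspace_TM)
  moreover have "continuous_map TM TM (\<lambda>z. x \<oplus>\<^bsub>M\<^esub> \<ominus>\<^bsub>M\<^esub> z)"
    using x by (intro continuous_map_add continuous_map_neg) (auto simp: topspace_TM)
  ultimately have "openin TM {z \<in> topspace TM. x \<oplus>\<^bsub>M\<^esub> \<ominus>\<^bsub>M\<^esub> z \<in> carrier M - C}"
    using openin_continuous_map_preimage by blast
  then obtain W where W: "W \<in> invariant_nbhds" "W \<subseteq> {z \<in> topspace TM. x \<oplus>\<^bsub>M\<^esub> \<ominus>\<^bsub>M\<^esub> z \<in> carrier M - C}"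
    by (rule invariant_nbhd_in_open) (use x \<open>x \<notin> C\<close> in \<open>simp add: topspace_TM minus_zero_eq\<close>)
  obtain c where c: "c \<in> C" "x \<ominus>\<^bsub>M\<^esub> c \<in> W" using approx[OF W(1)] by blast
  have cM: "c \<in> carrier M" using c CM by blast
  have "x \<oplus>\<^bsub>M\<^esub> \<ominus>\<^bsub>M\<^esub> (x \<ominus>\<^bsub>M\<^esub> c) = c"
    using x cM by (simp add: M.minus_eq M.minus_add M.r_neg2)
  then show False using W(2) c by auto
qed

text \<open>The zero submodule is closed by the Hausdorff property, so approximation by 0
  suffices.\<close>

lemma eq_zero_if_in_all_nbhds:
  assumes "x \<in> carrier M" and "\<And>W. W \<in> invariant_nbhds \<Longrightarrow> x \<in> W"
  shows "x = \<zero>\<^bsub>M\<^esub>"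
proof -
  have "closedin TM {\<zero>\<^bsub>M\<^esub>}"
    using additive.Hausdorff by (intro closedin_Hausdorff_singleton) (auto simp: topspace_TM)
  then have "x \<in> {\<zero>\<^bsub>M\<^esub>}"
    using assms by (intro mem_closed_if_approximable[of "{\<zero>\<^bsub>M\<^esub>}" x]) (auto simp: M.minus_eq minus_zero_eq)
  then show ?thesis by simp
qed

end

section \<open>The Fitting decomposition\<close>

context fg_profinite_module
begin

text \<open>By the pigeonhole principle two powers of f agree modulo W, so the powers are eventually
  periodic with some period d. A positive multiple e of d beyond the preperiod i is as
  required.\<close>

lemma idempotent_power_mod:
  assumes f: "f \<in> carrier End" and W: "submodule W R M" "openin TM W"
  obtains e :: nat where "0 < e"
    and "\<And>x. x \<in> carrier M \<Longrightarrow> (f [^]\<^bsub>End\<^esub> e) x \<ominus>\<^bsub>M\<^esub> (f [^]\<^bsub>End\<^esub> (e + e)) x \<in> W"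
proof -
  obtain \<kappa> :: "('m \<Rightarrow> 'm) \<Rightarrow> 'm \<Rightarrow> 'm set" where \<kappa>: "finite (\<kappa> ` carrier End)"
    "\<forall>f\<in>carrier End. \<forall>g\<in>carrier End. \<kappa> f = \<kappa> g \<longrightarrow> (\<forall>x\<in>carrier M. f x \<ominus>\<^bsub>M\<^esub> g x \<in> W)"
    using finite_End_mod[OF W] by (elim exE conjE)
  let ?p = "\<lambda>n::nat. f [^]\<^bsub>End\<^esub> n"
  have p: "?p n \<in> carrier End" for n using f by simp
  have "range (\<lambda>n. \<kappa> (?p n)) \<subseteq> \<kappa> ` carrier End" using p by auto
  then have "finite (range (\<lambda>n. \<kappa> (?p n)))" using \<kappa>(1) by (rule finite_subset)
  then have "\<not> inj (\<lambda>n. \<kappa> (?p n))" using range_inj_infinite by blast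
  then obtain i' j' where "\<kappa> (?p i') = \<kappa> (?p j')" "i' \<noteq> j'" unfolding inj_def by blast
  then obtain i j where ij: "\<kappa> (?p i) = \<kappa> (?p j)" "i < j"
    using that[of i' j'] that[of j' i'] by (cases "i' < j'") auto
  define d where "d = j - i"
  have d: "0 < d" "j = i + d" using ij(2) by (auto simp: d_def)
  have step: "(?p i) x \<ominus>\<^bsub>M\<^esub> (?p (i + d)) x \<in> W" if "x \<in> carrier M" for x
    using \<kappa>(2)[rule_format, OF p p ij(1) that] by (simp add: d(2))
  have period: "(?p i) x \<ominus>\<^bsub>M\<^esub> (?p (i + t * d)) x \<in> W" if "x \<in> carrier M" for x t
    using that
  proof (induction t arbitrary: x)
    case 0
    then show ?case using submodule_zero[OF W(1)] p by (simp add: M.minus_eq M.r_neg)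
  next
    case (Suc t)
    \<comment> \<open>Replacing x by f^d x shifts all exponents by d. Working on the argument side
      avoids applying f to a congruence, so W need not be invariant.\<close>
    let ?y = "(?p d) x"
    have y: "?y \<in> carrier M" using Suc.prems p by simp
    have "(?p i) x \<ominus>\<^bsub>M\<^esub> (?p i) ?y \<in> W"
      using step[OF Suc.prems] by (simp add: pow_End_add[OF f Suc.prems])
    moreover have "(?p i) ?y \<ominus>\<^bsub>M\<^esub> (?p (i + t * d)) ?y \<in> W" using Suc.IH[OF y] .
    moreover have "(?p (i + t * d)) ?y = (?p (i + Suc t * d)) x"
      using pow_End_add[OF f Suc.prems, of "i + t * d" d] by (simp add: ac_simps)
    ultimately show ?case
      using submodule_minus_trans[OF W(1) End_closed[OF p Suc.prems] End_closed[OF p y] End_closed[OF p y],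
          of i i "i + t * d"] by simp
  qed
  \<comment> \<open>A multiple of the period that is at least i; the successor keeps it positive
    even for i = 0.\<close>
  define e where "e = Suc i * d"
  have "i * 1 \<le> Suc i * d" using d(1) by (intro mult_le_mono) auto
  then have e: "0 < e" "i \<le> e" using d(1) by (simp_all add: e_def)
  have "(?p e) x \<ominus>\<^bsub>M\<^esub> (?p (e + e)) x \<in> W" if x: "x \<in> carrier M" for x
  proof -
    \<comment> \<open>At f^(e-i) x the periodicity from f^i to f^(i+e) becomes the congruence
      between f^e x and f^(2e) x.\<close>
    have "(?p (e - i)) x \<in> carrier M" using x p by simp
    from period[OF this, of "Suc i"] show ?thesis
      unfolding e_def[symmetric] pow_End_add[OF f x, symmetric] using e(2) by simp
  qed
  with e(1) show thesis by (rule that)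
qed

lemma idempotent_power_mult:
  assumes f: "f \<in> carrier End" and W: "submodule W R M"
    and e: "\<And>x. x \<in> carrier M \<Longrightarrow> (f [^]\<^bsub>End\<^esub> e) x \<ominus>\<^bsub>M\<^esub> (f [^]\<^bsub>End\<^esub> (e + e :: nat)) x \<in> W"
    and x: "x \<in> carrier M"
  shows "(f [^]\<^bsub>End\<^esub> e) x \<ominus>\<^bsub>M\<^esub> (f [^]\<^bsub>End\<^esub> (Suc n * e)) x \<in> W"
  using x
proof (induction n arbitrary: x)
  case 0
  then show ?case using f submodule_zero[OF W] by (simp add: M.minus_eq M.r_neg)
next
  case (Suc n)
  let ?y = "(f [^]\<^bsub>End\<^esub> e) x"
  have y: "?y \<in> carrier M" using f Suc.prems by simp
  have p: "f [^]\<^bsub>End\<^esub> n \<in> carrier End" for n :: nat using f by simp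
  have 1: "?y \<ominus>\<^bsub>M\<^esub> (f [^]\<^bsub>End\<^esub> e) ?y \<in> W"
    using e[OF Suc.prems] by (simp only: pow_End_add[OF f Suc.prems])
  have 2: "(f [^]\<^bsub>End\<^esub> e) ?y \<ominus>\<^bsub>M\<^esub> (f [^]\<^bsub>End\<^esub> (Suc n * e)) ?y \<in> W"
    by (rule Suc.IH[OF y])
  have "(f [^]\<^bsub>End\<^esub> (Suc n * e)) ?y = (f [^]\<^bsub>End\<^esub> (Suc n * e + e)) x"
    by (simp only: pow_End_add[OF f Suc.prems])
  also have "Suc n * e + e = Suc (Suc n) * e" by simp
  finally show ?case
    using submodule_minus_trans[OF W y End_closed[OF p y] End_closed[OF p y] 1 2] by simp
qed

text \<open>Each of the two powers is congruent to its own positive powers, hence both are congruent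
  to f^(e'e).\<close>

lemma idempotent_powers_agree:
  assumes f: "f \<in> carrier End" and W: "submodule W R M"
    and e: "0 < e" "\<And>x. x \<in> carrier M \<Longrightarrow> (f [^]\<^bsub>End\<^esub> e) x \<ominus>\<^bsub>M\<^esub> (f [^]\<^bsub>End\<^esub> (e + e :: nat)) x \<in> W"
    and e': "0 < e'" "\<And>x. x \<in> carrier M \<Longrightarrow> (f [^]\<^bsub>End\<^esub> e') x \<ominus>\<^bsub>M\<^esub> (f [^]\<^bsub>End\<^esub> (e' + e' :: nat)) x \<in> W"
    and x: "x \<in> carrier M"
  shows "(f [^]\<^bsub>End\<^esub> e) x \<ominus>\<^bsub>M\<^esub> (f [^]\<^bsub>End\<^esub> e') x \<in> W"
proof -
  have p: "(f [^]\<^bsub>End\<^esub> n) x \<in> carrier M" for n :: nat using f x by simp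
  have "(f [^]\<^bsub>End\<^esub> e) x \<ominus>\<^bsub>M\<^esub> (f [^]\<^bsub>End\<^esub> (e' * e)) x \<in> W"
    \<comment> \<open>The multiplier there is a successor, hence the shift by one; it is harmless
      since \<open>e'\<close> is positive.\<close>
    using idempotent_power_mult[OF f W e(2) x, of "e' - 1"] e'(1) by simp
  moreover have "(f [^]\<^bsub>End\<^esub> e') x \<ominus>\<^bsub>M\<^esub> (f [^]\<^bsub>End\<^esub> (e' * e)) x \<in> W"
    using idempotent_power_mult[OF f W e'(2) x, of "e - 1"] e(1) by (simp add: mult.commute)
  ultimately show ?thesis
    using submodule_minus_trans[OF W p p p] submodule_minus_sym[OF W p p] by blast
qed

text \<open>The idempotents modulo the various W are compatible and split U into
  \<open>U\<^sub>0\<close> and \<open>U\<^sub>1\<close>, one of which vanishes. If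
  \<open>U\<^sub>0\<close> is zero, suitable positive powers of f approximate the identity and f is
  bijective; if \<open>U\<^sub>1\<close> is zero, suitable powers map U into W.\<close>

lemma Fitting_dichotomy:
  assumes indec: "indecomposable R M TM" and f: "f \<in> carrier End"
  shows "f \<in> Units End \<or> (\<forall>W\<in>invariant_nbhds. \<exists>n::nat. \<forall>x\<in>carrier M. (f [^]\<^bsub>End\<^esub> n) x \<in> W)"
proof -
  have "\<forall>W\<in>invariant_nbhds. \<exists>e::nat. 0 < e \<and>
      (\<forall>x\<in>carrier M. (f [^]\<^bsub>End\<^esub> e) x \<ominus>\<^bsub>M\<^esub> (f [^]\<^bsub>End\<^esub> (e + e)) x \<in> W)"
  proof
    fix W assume "W \<in> invariant_nbhds"
    from invariant_nbhdsD(1,2)[OF this] obtain e :: nat where "0 < e"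
      "\<And>x. x \<in> carrier M \<Longrightarrow> (f [^]\<^bsub>End\<^esub> e) x \<ominus>\<^bsub>M\<^esub> (f [^]\<^bsub>End\<^esub> (e + e)) x \<in> W"
      using idempotent_power_mod[OF f] by blast
    then show "\<exists>e::nat. 0 < e \<and>
      (\<forall>x\<in>carrier M. (f [^]\<^bsub>End\<^esub> e) x \<ominus>\<^bsub>M\<^esub> (f [^]\<^bsub>End\<^esub> (e + e)) x \<in> W)" by blast
  qed
  then obtain \<epsilon> :: "'m set \<Rightarrow> nat" where \<epsilon>: "\<forall>W\<in>invariant_nbhds. 0 < \<epsilon> W \<and>
      (\<forall>x\<in>carrier M. (f [^]\<^bsub>End\<^esub> \<epsilon> W) x \<ominus>\<^bsub>M\<^esub> (f [^]\<^bsub>End\<^esub> (\<epsilon> W + \<epsilon> W)) x \<in> W)"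
    unfolding bchoice_iff by (elim exE)
  define q where "q W = f [^]\<^bsub>End\<^esub> \<epsilon> W" for W
  have q: "q W \<in> carrier End" for W using f by (simp add: q_def)
  have \<epsilon>_pos: "0 < \<epsilon> W" if "W \<in> invariant_nbhds" for W using \<epsilon> that by blast
  have \<epsilon>_idem: "(f [^]\<^bsub>End\<^esub> \<epsilon> W) x \<ominus>\<^bsub>M\<^esub> (f [^]\<^bsub>End\<^esub> (\<epsilon> W + \<epsilon> W)) x \<in> W"
    if "W \<in> invariant_nbhds" "x \<in> carrier M" for W x using \<epsilon> that by blast
  have q_idem: "q W x \<ominus>\<^bsub>M\<^esub> q W (q W x) \<in> W" if "W \<in> invariant_nbhds" "x \<in> carrier M" for W x
    using \<epsilon>_idem[OF that] unfolding q_def pow_End_add[OF f that(2)] .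
  \<comment> \<open>A congruence modulo the smaller \<open>W'\<close> also holds modulo W, so both
    exponents give idempotent powers modulo W.\<close>
  have q_agree: "q W' x \<ominus>\<^bsub>M\<^esub> q W x \<in> W"
    if W: "W \<in> invariant_nbhds" and W': "W' \<in> invariant_nbhds" "W' \<subseteq> W" and x: "x \<in> carrier M" for W W' x
    unfolding q_def
    using idempotent_powers_agree[OF f invariant_nbhdsD(1)[OF W] \<epsilon>_pos[OF W'(1)] _ \<epsilon>_pos[OF W]
        \<epsilon>_idem[OF W] x] \<epsilon>_idem[OF W'(1)] W'(2) by blast

  \<comment> \<open>\<open>N W\<close> is the kernel of \<open>q W\<close> modulo W, and
    \<open>I W\<close> is its image modulo W, written as the kernel of 1 - \<open>q W\<close>. Both
    are thus preimages of W, hence closed submodules.\<close>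
  define N where "N W = {x \<in> carrier M. q W x \<in> W}" for W
  define I where "I W = {x \<in> carrier M. (\<one>\<^bsub>End\<^esub> \<ominus>\<^bsub>End\<^esub> q W) x \<in> W}" for W
  define U\<^sub>0 where "U\<^sub>0 = \<Inter>(N ` invariant_nbhds)"
  define U\<^sub>1 where "U\<^sub>1 = \<Inter>(I ` invariant_nbhds)"
  have ne: "invariant_nbhds \<noteq> {}" using carrier_in_invariant_nbhds by blast
  have one_q: "\<one>\<^bsub>End\<^esub> \<ominus>\<^bsub>End\<^esub> q W \<in> carrier End" for W using q by simp
  have I_iff: "x \<in> I W \<longleftrightarrow> x \<in> carrier M \<and> x \<ominus>\<^bsub>M\<^esub> q W x \<in> W" for x W
    unfolding I_def using minus_End_apply[OF End.one_closed q] by auto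
  have U\<^sub>0M: "U\<^sub>0 \<subseteq> carrier M" and U\<^sub>1M: "U\<^sub>1 \<subseteq> carrier M"
    using carrier_in_invariant_nbhds unfolding U\<^sub>0_def U\<^sub>1_def N_def I_def by blast+
  have "profinite_submodule R M TM U\<^sub>0"
    unfolding profinite_submodule_def U\<^sub>0_def N_def using ne invariant_nbhdsD(1,3)
    by (intro conjI submodule_Inter closedin_Inter) (auto intro: submodule_preimage closedin_preimage q)
  moreover have "profinite_submodule R M TM U\<^sub>1"
    unfolding profinite_submodule_def U\<^sub>1_def I_def using ne invariant_nbhdsD(1,3)
    by (intro conjI submodule_Inter closedin_Inter)
      (auto intro: submodule_preimage[OF one_q] closedin_preimage[OF one_q])
  moreover have "U\<^sub>0 \<inter> U\<^sub>1 = {\<zero>\<^bsub>M\<^esub>}"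
  proof -
    have "x = \<zero>\<^bsub>M\<^esub>" if x: "x \<in> U\<^sub>0" "x \<in> U\<^sub>1" for x
    proof (rule eq_zero_if_in_all_nbhds)
      show xM: "x \<in> carrier M" using x U\<^sub>0M by blast
      fix W assume W: "W \<in> invariant_nbhds"
      have "q W x \<in> W" using x(1) W unfolding U\<^sub>0_def N_def by blast
      moreover have "x \<ominus>\<^bsub>M\<^esub> q W x \<in> W" using x(2) W I_iff unfolding U\<^sub>1_def by blast
      ultimately show "x \<in> W" using submodule_mem_cong[OF invariant_nbhdsD(1)[OF W] xM] by blast
    qed
    moreover have "\<zero>\<^bsub>M\<^esub> \<in> U\<^sub>0" "\<zero>\<^bsub>M\<^esub> \<in> U\<^sub>1"
      using \<open>profinite_submodule R M TM U\<^sub>0\<close> \<open>profinite_submodule R M TM U\<^sub>1\<close> submodule_zero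
      unfolding profinite_submodule_def by auto
    ultimately show ?thesis by blast
  qed
  moreover have sum: "U\<^sub>0 <+>\<^bsub>M\<^esub> U\<^sub>1 = carrier M"
  proof
    show "U\<^sub>0 <+>\<^bsub>M\<^esub> U\<^sub>1 \<subseteq> carrier M"
      using U\<^sub>0M U\<^sub>1M unfolding set_add_def set_mult_def by auto
    show "carrier M \<subseteq> U\<^sub>0 <+>\<^bsub>M\<^esub> U\<^sub>1"
    proof
      fix x assume x: "x \<in> carrier M"
      \<comment> \<open>\<open>y\<close> is the limit of the powers \<open>q W x\<close>, obtained by compactness.\<close>
      define D where "D W = {y \<in> carrier M. y \<ominus>\<^bsub>M\<^esub> q W x \<in> W}" for W
      have "closedin TM (D W)" if W: "W \<in> invariant_nbhds" for W
      proof -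
        have "continuous_map TM TM (\<lambda>y. y \<oplus>\<^bsub>M\<^esub> \<ominus>\<^bsub>M\<^esub> q W x)"
          using x q by (intro continuous_map_add) (auto simp: topspace_TM)
        from closedin_continuous_map_preimage[OF this invariant_nbhdsD(3)[OF W]]
        show ?thesis by (simp add: D_def topspace_TM M.minus_eq)
      qed
      moreover have "\<Inter>\<F> \<noteq> {}" if fin: "finite \<F>" and sub: "\<F> \<subseteq> D ` invariant_nbhds" for \<F>
      proof -
        obtain F where F: "F \<subseteq> invariant_nbhds" "finite F" "\<F> = D ` F"
          using finite_subset_image[OF fin sub] by blast
        \<comment> \<open>The exponent for the common refinement of the finitely many W serves them
          all by \<open>q_agree\<close>. The inserted \<open>carrier M\<close> covers the case of an
          empty F.\<close>
        define W\<^sub>0 where "W\<^sub>0 = \<Inter>(insert (carrier M) F)"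
        have "insert (carrier M) F \<subseteq> invariant_nbhds" "finite (insert (carrier M) F)"
          using F carrier_in_invariant_nbhds by auto
        then have W\<^sub>0: "W\<^sub>0 \<in> invariant_nbhds"
          unfolding W\<^sub>0_def by (intro invariant_nbhds_Inter) auto
        have "q W\<^sub>0 x \<in> D W" if "W \<in> F" for W
        proof -
          have "W \<in> invariant_nbhds" using that F(1) by blast
          moreover have "W\<^sub>0 \<subseteq> W" using that unfolding W\<^sub>0_def by blast
          ultimately show ?thesis using q_agree[OF _ W\<^sub>0 _ x] x q by (simp add: D_def)
        qed
        then show ?thesis unfolding F(3) by blast
      qed
      ultimately have "\<Inter>(D ` invariant_nbhds) \<noteq> {}"
        using additive.compact[unfolded compact_space_fip, rule_format, of "D ` invariant_nbhds"] by blast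
      then obtain y where y: "\<And>W. W \<in> invariant_nbhds \<Longrightarrow> y \<in> D W" by blast
      have yM: "y \<in> carrier M" using y[OF carrier_in_invariant_nbhds] by (simp add: D_def)
      have y_cong: "y \<ominus>\<^bsub>M\<^esub> q W x \<in> W" if "W \<in> invariant_nbhds" for W
        using y[OF that] by (simp add: D_def)
      \<comment> \<open>Invariance of W allows applying \<open>q W\<close> to the congruence of y
        with \<open>q W x\<close>; idempotency modulo W then removes the doubled
        \<open>q W\<close>.\<close>
      have q_cong: "q W x \<ominus>\<^bsub>M\<^esub> q W y \<in> W" if W: "W \<in> invariant_nbhds" for W
      proof -
        have sW: "submodule W R M" using invariant_nbhdsD(1)[OF W] .
        have "q W (y \<ominus>\<^bsub>M\<^esub> q W x) \<in> W" using invariant_nbhdsD(4)[OF W q y_cong[OF W]] .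
        then have "q W y \<ominus>\<^bsub>M\<^esub> q W (q W x) \<in> W" using End_minus[OF q yM, of "q W x" W] q x by simp
        then have "q W (q W x) \<ominus>\<^bsub>M\<^esub> q W y \<in> W"
          using submodule_minus_sym[OF sW] q x yM by simp
        then show ?thesis
          using submodule_minus_trans[OF sW _ _ _ q_idem[OF W x]] q x yM by simp
      qed
      have "y \<in> U\<^sub>1"
        unfolding U\<^sub>1_def
        using I_iff yM submodule_minus_trans[OF invariant_nbhdsD(1) yM _ _ y_cong q_cong] q x by auto
      moreover have "x \<ominus>\<^bsub>M\<^esub> y \<in> U\<^sub>0"
        unfolding U\<^sub>0_def N_def using x yM q_cong End_minus[OF q x yM] by auto
      moreover have "x = (x \<ominus>\<^bsub>M\<^esub> y) \<oplus>\<^bsub>M\<^esub> y"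
        using x yM by (simp add: M.minus_eq M.a_assoc M.l_neg)
      ultimately show "x \<in> U\<^sub>0 <+>\<^bsub>M\<^esub> U\<^sub>1"
        unfolding set_add_def set_mult_def by auto
    qed
  qed
  ultimately have "U\<^sub>0 = {\<zero>\<^bsub>M\<^esub>} \<or> U\<^sub>1 = {\<zero>\<^bsub>M\<^esub>}"
    using indec unfolding indecomposable_def by blast
  then show ?thesis
  proof
    assume U\<^sub>0: "U\<^sub>0 = {\<zero>\<^bsub>M\<^esub>}"
    have "U\<^sub>1 = carrier M"
      using sum U\<^sub>1M unfolding U\<^sub>0 set_add_def set_mult_def by (auto simp: subset_iff)
    then have approx: "x \<ominus>\<^bsub>M\<^esub> q W x \<in> W" if "x \<in> carrier M" "W \<in> invariant_nbhds" for x W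
      using that I_iff unfolding U\<^sub>1_def by blast
    \<comment> \<open>As the exponent is positive, one factor f splits off on either side: on the
      right for injectivity, on the left for surjectivity.\<close>
    have q_Suc: "q W = f \<otimes>\<^bsub>End\<^esub> (f [^]\<^bsub>End\<^esub> (\<epsilon> W - 1))" "q W = (f [^]\<^bsub>End\<^esub> (\<epsilon> W - 1)) \<otimes>\<^bsub>End\<^esub> f"
      if W: "W \<in> invariant_nbhds" for W
      using \<epsilon>_pos[OF W] End.nat_pow_Suc2[OF f, of "\<epsilon> W - 1"] End.nat_pow_Suc[of f "\<epsilon> W - 1"]
      by (simp_all add: q_def)
    have kernel: "x = \<zero>\<^bsub>M\<^esub>" if x: "x \<in> carrier M" and fx: "f x = \<zero>\<^bsub>M\<^esub>" for x
    proof (rule eq_zero_if_in_all_nbhds[OF x])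
      fix W assume W: "W \<in> invariant_nbhds"
      have "q W x = \<zero>\<^bsub>M\<^esub>"
        unfolding q_Suc(2)[OF W] using x f by (simp add: fx End_zero)
      then show "x \<in> W" using approx[OF x W] x by (simp add: M.minus_eq minus_zero_eq)
    qed
    have "inj_on f (carrier M)"
    proof (rule inj_onI)
      fix x y assume xy: "x \<in> carrier M" "y \<in> carrier M" "f x = f y"
      then have "f (x \<ominus>\<^bsub>M\<^esub> y) = \<zero>\<^bsub>M\<^esub>"
        using End_minus[OF f xy(1,2)] f by (simp add: M.minus_eq M.r_neg)
      then have "x \<ominus>\<^bsub>M\<^esub> y = \<zero>\<^bsub>M\<^esub>" using kernel xy by simp
      then show "x = y" using M.minus_equality[of x "\<ominus>\<^bsub>M\<^esub> y"] xy by (simp add: M.minus_eq)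
    qed
    moreover have "f ` carrier M = carrier M"
    proof
      show "f ` carrier M \<subseteq> carrier M" using f by auto
      \<comment> \<open>A closed image contains every x that the values \<open>q W x\<close>, which
        lie in the image, approximate.\<close>
      have closed: "closedin TM (f ` carrier M)"
        using continuous_imp_closed_map[OF End_continuous[OF f] additive.compact additive.Hausdorff]
          closedin_topspace[of TM] unfolding closed_map_def topspace_TM by blast
      show "carrier M \<subseteq> f ` carrier M"
      proof
        fix x assume x: "x \<in> carrier M"
        show "x \<in> f ` carrier M"
        proof (rule mem_closed_if_approximable[OF closed x])
          fix W assume W: "W \<in> invariant_nbhds"
          have "q W x \<in> f ` carrier M" unfolding q_Suc(1)[OF W] using x f by simp
          then show "\<exists>c\<in>f ` carrier M. x \<ominus>\<^bsub>M\<^esub> c \<in> W" using approx[OF x W] by blast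
        qed
      qed
    qed
    ultimately have "f \<in> Units End"
      using bijective_End_is_unit[OF f] by (simp add: bij_betw_def)
    then show ?thesis ..
  next
    assume U\<^sub>1: "U\<^sub>1 = {\<zero>\<^bsub>M\<^esub>}"
    have "U\<^sub>0 = carrier M"
      using sum U\<^sub>0M unfolding U\<^sub>1 set_add_def set_mult_def by (auto simp: subset_iff)
    then have "\<forall>x\<in>carrier M. (f [^]\<^bsub>End\<^esub> \<epsilon> W) x \<in> W" if "W \<in> invariant_nbhds" for W
      using that unfolding U\<^sub>0_def N_def q_def by blast
    then show ?thesis by blast
  qed
qed

text \<open>The last iterate y of f on some x that is still outside W satisfies f y \<in> W. So 1 -
  f and all its powers fix y modulo W, which contradicts its nilpotency modulo W.\<close>

lemma not_both_topologically_nilpotent: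
  assumes f: "f \<in> carrier End" and W: "W \<in> invariant_nbhds" "W \<noteq> carrier M"
    and n: "\<And>x. x \<in> carrier M \<Longrightarrow> (f [^]\<^bsub>End\<^esub> (n::nat)) x \<in> W"
    and m: "\<And>x. x \<in> carrier M \<Longrightarrow> ((\<one>\<^bsub>End\<^esub> \<ominus>\<^bsub>End\<^esub> f) [^]\<^bsub>End\<^esub> (m::nat)) x \<in> W"
  shows False
proof -
  have sW: "submodule W R M" using invariant_nbhdsD(1)[OF W(1)] .
  let ?g = "\<one>\<^bsub>End\<^esub> \<ominus>\<^bsub>End\<^esub> f"
  have g: "?g \<in> carrier End" using f by simp
  have p: "f [^]\<^bsub>End\<^esub> i \<in> carrier End" "?g [^]\<^bsub>End\<^esub> i \<in> carrier End" for i :: nat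
    using f g by (simp_all del: End.minus_closed)
  have "W \<subseteq> carrier M" using submodule_carrier[OF sW] by blast
  then obtain x where x: "x \<in> carrier M" "x \<notin> W" using W(2) by blast
  define l where "l = (LEAST i. (f [^]\<^bsub>End\<^esub> (i::nat)) x \<in> W)"
  have l: "(f [^]\<^bsub>End\<^esub> l) x \<in> W" unfolding l_def by (rule LeastI[of _ n]) (rule n[OF x(1)])
  \<comment> \<open>The zeroth power fixes x, which is outside W; hence the exponent l - 1 makes
    sense.\<close>
  have "l \<noteq> 0" using l x by (cases "l = 0") auto
  define y where "y = (f [^]\<^bsub>End\<^esub> (l - 1)) x"
  have y: "y \<in> carrier M" using x p by (simp add: y_def)
  have "y \<notin> W"
    unfolding y_def using not_less_Least[of "l - 1" "\<lambda>i. (f [^]\<^bsub>End\<^esub> i) x \<in> W"] \<open>l \<noteq> 0\<close>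
    by (simp add: l_def)
  have "f y \<in> W"
    using l \<open>l \<noteq> 0\<close> pow_End_add[OF f x(1), of 1 "l - 1"] f by (simp add: y_def)
  \<comment> \<open>The difference y - (y - f y) is just f y.\<close>
  then have y_cong: "y \<ominus>\<^bsub>M\<^esub> ?g y \<in> W"
    using f y by (simp add: M.minus_eq M.minus_add M.r_neg2 M.r_neg1)
  have "y \<ominus>\<^bsub>M\<^esub> (?g [^]\<^bsub>End\<^esub> i) y \<in> W" for i :: nat
  proof (induction i)
    case 0
    then show ?case using y submodule_zero[OF sW] by (simp add: M.minus_eq M.r_neg)
  next
    case (Suc i)
    have "(?g [^]\<^bsub>End\<^esub> i) (y \<ominus>\<^bsub>M\<^esub> ?g y) \<in> W"
      using invariant_nbhdsD(4)[OF W(1) p(2) y_cong] .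
    then have "(?g [^]\<^bsub>End\<^esub> i) y \<ominus>\<^bsub>M\<^esub> (?g [^]\<^bsub>End\<^esub> Suc i) y \<in> W"
      using End_minus[OF p(2) y End_closed[OF g y], of i] y by simp
    with Suc show ?case
      using submodule_minus_trans[OF sW y End_closed[OF p(2) y] End_closed[OF p(2) y]] by blast
  qed
  then have "y \<in> W"
    using submodule_mem_cong[OF sW y m[OF y]] by blast
  with \<open>y \<notin> W\<close> show False ..
qed

text \<open>A single proper W suffices: if neither f nor 1 - f were a unit, the Fitting dichotomy
  would make both nilpotent modulo W.\<close>

lemma indecomposable_imp_local_ring_End:
  assumes indec: "indecomposable R M TM"
  shows "local_ring End"
proof (rule End.unit_or_one_minus_unit_imp_local_ring)
  have "carrier M \<noteq> {\<zero>\<^bsub>M\<^esub>}" using indec by (simp add: indecomposable_def)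
  then obtain z where z: "z \<in> carrier M" "z \<noteq> \<zero>\<^bsub>M\<^esub>" using M.zero_closed by blast
  show "\<one>\<^bsub>End\<^esub> \<noteq> \<zero>\<^bsub>End\<^esub>"
    using one_End_apply[OF z(1)] zero_End_apply[OF z(1)] z(2) by force
  \<comment> \<open>The open invariant submodules intersect in zero, so a nonzero z is missed by one
    of them.\<close>
  have "\<exists>W\<in>invariant_nbhds. z \<notin> W" using eq_zero_if_in_all_nbhds[OF z(1)] z(2) by blast
  then obtain W where W: "W \<in> invariant_nbhds" "W \<noteq> carrier M" using z(1) by blast
  fix f assume f: "f \<in> carrier End"
  have g: "\<one>\<^bsub>End\<^esub> \<ominus>\<^bsub>End\<^esub> f \<in> carrier End" using f by simp
  show "f \<in> Units End \<or> \<one>\<^bsub>End\<^esub> \<ominus>\<^bsub>End\<^esub> f \<in> Units End"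
  proof (rule ccontr)
    assume "\<not> ?thesis"
    then obtain n m :: nat where "\<forall>x\<in>carrier M. (f [^]\<^bsub>End\<^esub> n) x \<in> W"
      "\<forall>x\<in>carrier M. ((\<one>\<^bsub>End\<^esub> \<ominus>\<^bsub>End\<^esub> f) [^]\<^bsub>End\<^esub> m) x \<in> W"
      using Fitting_dichotomy[OF indec f] Fitting_dichotomy[OF indec g] W(1) by blast
    then show False using not_both_topologically_nilpotent[OF f W, of n m] by blast
  qed
qed

end

theorem proposition4p4:
  fixes k :: "('k, 'a) ring_scheme"
    and p :: nat
    and G :: "('g, 'b) monoid_scheme"
    and TG :: "'g topology"
    and U :: "('g set \<Rightarrow> 'g set \<Rightarrow> 'k, 'u, 'c) module_scheme"
    and TU :: "'u topology"
  assumes "field k" and "finite (carrier k)" and "ring_characteristic k = p"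
    and "profinite_group G TG"
    and "profinite_module (completed_group_algebra k G TG)
           (completed_group_algebra_topology k G TG) U TU"
    and "finitely_generated (completed_group_algebra k G TG) U TU"
    and "indecomposable (completed_group_algebra k G TG) U TU"
  shows "local_ring (endomorphism_ring (completed_group_algebra k G TG) U TU)"
proof -
  \<comment> \<open>Finiteness of k and profiniteness of G enter through the compactness of the
    completed group algebra.\<close>
  interpret fg_profinite_module "completed_group_algebra k G TG"
      "completed_group_algebra_topology k G TG" U TU
    using assms(5,6) compact_space_completed_group_algebra[OF assms(4,2)]
    by (simp add: fg_profinite_module_def fg_profinite_module_axioms_def)
  show ?thesis by (rule indecomposable_imp_local_ring_End[OF assms(7)])
qed

end
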